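(* Let $M\subset\mathbb{C}^{N}$ and $M'\subset\mathbb{C}^{N'}$ be generic real-analytic submanifolds with $0\in M$ and $0\in M'$, and let $H:M\to M'$ be a CR-map of class $C^{k_0}$ with $H(0)=0$. Let $\tilde Z'=F(Z')$ be a local biholomorphic change of coordinates near $0$ in $\mathbb{C}^{N'}$ with $F(0)=0$. For $0\le k\le k_0$ let $E_k(0)\subset\mathbb{C}^{N'}$ be the space associated with $H:M\to M'$ as defined in the context, and let $\tilde E_k(0)\subset\mathbb{C}^{N'}$ be the corresponding space in the new coordinates, i.e. the one associated in the same way with the map $F\circ H$ from $M$ (near $0$) into $F(M')$. Then, regarding $E_k(0)$ and $\tilde E_k(0)$ as spaces of row vectors, $$\tilde E_k(0)=E_k(0)\left(\frac{\partial F}{\partial Z'}(0)\right)^{-1}.$$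
   Context: Generic submanifolds: a real-analytic submanifold $M\subset\mathbb{C}^N$ of real codimension $d$ is generic if near each of its points it is given by $\rho=0$ for a real-analytic $\mathbb{R}^d$-valued function $\rho=(\rho_1,\dots,\rho_d)$ (a local defining function) whose complex gradients $\rho_{j Z}=(\partial\rho_j/\partial Z_1,\dots,\partial\rho_j/\partial Z_N)$, $1\le j\le d$, are linearly independent over $\mathbb{C}$. CR-bundle: $\mathcal{V}(M)$ denotes the CR-bundle of $M$, i.e. the bundle of $(0,1)$-vectors (linear combinations of the $\partial/\partial\bar Z_j$) tangent to $M$; $\Gamma(M,\mathcal{V}(M))$ denotes its smooth sections near $0$ (CR-vector fields). A CR-function on $M$ is a function annihilated by all CR-vector fields (in the sense of distributions if it is only continuous). A CR-map $H:M\to M'$ is a map whose components in holomorphic coordinates $(Z_1',\dots,Z'_{N'})$ of $\mathbb{C}^{N'}$ are CR-functions on $M$. The spaces $E_k(0)$: let $d'$ be the real codimension of $M'$, and let $\rho'=(\rho'_1,\dots,\rho'_{d'})$ be a local real-analytic defining function for $M'$ near $0\in\mathbb{C}^{N'}$, with complex gradients (row vectors) $\rho'_{l Z'}=(\rho'_{l Z'_1},\dots,\rho'_{l Z'_{N'}})$, where the subscript $Z'_j$ denotes $\partial/\partial Z'_j$. For $0\le k\le k_0$, $$E_k(0)=\operatorname{span}_{\mathbb{C}}\Bigl\{L_1\cdots L_j\,\rho'_{l Z'}\bigl(H(Z),\overline{H(Z)}\bigr)\Big|_{Z=0}: L_r\in\Gamma(M,\mathcal{V}(M))\text{ for }1\le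 r\le j,\ 0\le j\le k,\ 1\le l\le d'\Bigr\}.$$ (The vector fields act componentwise on the vector-valued function $Z\mapsto\rho'_{lZ'}(H(Z),\overline{H(Z)})$ on $M$.) The spaces $E_k(0)$ do not depend on the choice of defining function $\rho'$. Here $\frac{\partial F}{\partial Z'}$ is the Jacobian matrix with $(i,j)$ entry $\partial F_i/\partial Z'_j$. *)

theory Defs
  imports "HOL-Analysis.Analysis"
begin

section \<open>Functions of class \<open>C\<^sup>k\<close>, real-analytic functions, biholomorphisms\<close>

text \<open>Meant for open \<open>U\<close>. The second clause quantifies over all directions \<open>v\<close>, which amounts
  to all first-order partial derivatives being of class \<open>C\<^sup>k\<close>.\<close>

primrec Ck_on :: "nat \<Rightarrow> ('a::euclidean_space \<Rightarrow> 'b::real_normed_vector) \<Rightarrow> 'a set \<Rightarrow> bool" where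
  "Ck_on 0 f U \<longleftrightarrow> continuous_on U f"
| "Ck_on (Suc k) f U \<longleftrightarrow>
     (\<forall>x\<in>U. f differentiable (at x)) \<and>
     (\<forall>v. Ck_on k (\<lambda>x. frechet_derivative f (at x) v) U)"

definition smooth_on :: "('a::euclidean_space \<Rightarrow> 'b::real_normed_vector) \<Rightarrow> 'a set \<Rightarrow> bool" where
  "smooth_on f U \<longleftrightarrow> (\<forall>k. Ck_on k f U)"

text \<open>Regularity of a function on a (locally closed) submanifold \<open>S\<close>: local extendability to an
  ambient function of the same class. The values of \<open>f\<close> off \<open>S\<close> play no role.\<close>

definition Ck_on_submanifold ::
    "nat \<Rightarrow> ('a::euclidean_space \<Rightarrow> 'b::real_normed_vector) \<Rightarrow> 'a set \<Rightarrow> bool" where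
  "Ck_on_submanifold k f S \<longleftrightarrow>
     (\<forall>p\<in>S. \<exists>V g. open V \<and> p \<in> V \<and> Ck_on k g V \<and> (\<forall>x\<in>S \<inter> V. g x = f x))"

definition smooth_on_submanifold ::
    "('a::euclidean_space \<Rightarrow> 'b::real_normed_vector) \<Rightarrow> 'a set \<Rightarrow> bool" where
  "smooth_on_submanifold f S \<longleftrightarrow>
     (\<forall>p\<in>S. \<exists>V g. open V \<and> p \<in> V \<and> smooth_on g V \<and> (\<forall>x\<in>S \<inter> V. g x = f x))"

text \<open>Local expansion in a power series in the real coordinates; the multi-indices are the
  functions from \<open>Basis\<close> to the natural numbers (undefined off \<open>Basis\<close>).\<close>

definition real_analytic_on :: "('a::euclidean_space \<Rightarrow> real) \<Rightarrow> 'a set \<Rightarrow> bool" where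
  "real_analytic_on f U \<longleftrightarrow>
     (\<forall>p\<in>U. \<exists>r>0. \<exists>c :: ('a \<Rightarrow> nat) \<Rightarrow> real. \<forall>x\<in>ball p r.
        ((\<lambda>\<alpha>. c \<alpha> * (\<Prod>b\<in>Basis. ((x - p) \<bullet> b) ^ \<alpha> b)) has_sum f x)
          (Basis \<rightarrow>\<^sub>E (UNIV :: nat set)))"

definition holomorphic_map_on :: "(complex^'n \<Rightarrow> complex^'m) \<Rightarrow> (complex^'n) set \<Rightarrow> bool" where
  "holomorphic_map_on F U \<longleftrightarrow>
     (\<forall>z\<in>U. \<exists>A :: complex^'n^'m. (F has_derivative (\<lambda>h. A *v h)) (at z))"

definition biholomorphic_on :: "(complex^'n \<Rightarrow> complex^'n) \<Rightarrow> (complex^'n) set \<Rightarrow> bool" where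
  "biholomorphic_on F U \<longleftrightarrow>
     open U \<and> holomorphic_map_on F U \<and> open (F ` U) \<and>
     (\<exists>G. holomorphic_map_on G (F ` U) \<and> (\<forall>z\<in>U. G (F z) = z))"


section \<open>Wirtinger derivatives\<close>

text \<open>\<open>\<partial>f/\<partial>Z\<^sub>j = (\<partial>f/\<partial>x\<^sub>j - i \<partial>f/\<partial>y\<^sub>j)/2\<close> at \<open>p\<close>, where \<open>Z\<^sub>j = x\<^sub>j + i y\<^sub>j\<close>.\<close>

definition dZ :: "'n \<Rightarrow> (complex^'n \<Rightarrow> complex) \<Rightarrow> complex^'n \<Rightarrow> complex" where
  "dZ j f p = (frechet_derivative f (at p) (axis j 1)
               - \<i> * frechet_derivative f (at p) (axis j \<i>)) / 2"

definition complex_gradient :: "(complex^'n \<Rightarrow> real) \<Rightarrow> complex^'n \<Rightarrow> complex^'n" where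
  "complex_gradient \<rho> p = (\<chi> j. dZ j (\<lambda>Z. complex_of_real (\<rho> Z)) p)"

definition jacobian_Z :: "(complex^'n \<Rightarrow> complex^'m) \<Rightarrow> complex^'n \<Rightarrow> complex^'n^'m" where
  "jacobian_Z F p = (\<chi> i j. dZ j (\<lambda>Z. F Z $ i) p)"

text \<open>Action of the \<open>(0,1)\<close>-vector field \<open>L = \<Sum>\<^sub>j a\<^sub>j \<partial>/\<partial>Z\<^sup>-\<^sub>j\<close> (with
  \<open>\<partial>/\<partial>Z\<^sup>-\<^sub>j = (\<partial>/\<partial>x\<^sub>j + i \<partial>/\<partial>y\<^sub>j)/2\<close>) on a function \<open>f\<close> on \<open>S\<close>. The derivative of \<open>f\<close> within a
  submanifold \<open>S\<close> is determined only on the tangent space of \<open>S\<close>. However, \<open>L f\<close> at \<open>p\<close> equals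
  \<open>(D (cnj a) + i D (i cnj a))/2\<close> for the derivative \<open>D\<close>, and \<open>cnj a\<close> and \<open>i cnj a\<close> are tangent to
  \<open>S\<close> at \<open>p\<close> if \<open>L\<close> is; so for tangential \<open>L\<close> the value does not depend on the choice of \<open>D\<close>, and
  depends on \<open>f\<close> only through its values on \<open>S\<close> near \<open>p\<close>.\<close>

definition bar_field ::
    "(complex^'n) set \<Rightarrow> (complex^'n \<Rightarrow> complex^'n) \<Rightarrow> (complex^'n \<Rightarrow> complex) \<Rightarrow>
     complex^'n \<Rightarrow> complex" where
  "bar_field S a f p =
     (\<Sum>j\<in>UNIV. a p $ j * ((frechet_derivative f (at p within S) (axis j 1)
                + \<i> * frechet_derivative f (at p within S) (axis j \<i>)) / 2))"


section \<open>Generic real-analytic submanifolds\<close>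

text \<open>The components of a defining function with values in \<open>\<real>\<^sup>d\<close> are \<open>\<rho> 0, \<dots>, \<rho> (d - 1)\<close>. As
  \<open>U\<close> may be shrunk, it makes no difference whether independence of the complex gradients is
  required at \<open>p\<close> or on all of \<open>U\<close>.\<close>

definition local_defining_function ::
    "(complex^'n) set \<Rightarrow> nat \<Rightarrow> complex^'n \<Rightarrow> (nat \<Rightarrow> complex^'n \<Rightarrow> real) \<Rightarrow> bool" where
  "local_defining_function M d p \<rho> \<longleftrightarrow>
     (\<exists>U. open U \<and> p \<in> U \<and>
        M \<inter> U = {Z \<in> U. \<forall>j<d. \<rho> j Z = 0} \<and>
        (\<forall>j<d. real_analytic_on (\<rho> j) U) \<and>
        (\<forall>Z\<in>U. \<forall>c :: nat \<Rightarrow> complex.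
           (\<Sum>j<d. c j *s complex_gradient (\<rho> j) Z) = 0 \<longrightarrow> (\<forall>j<d. c j = 0)))"

definition generic_submanifold :: "(complex^'n) set \<Rightarrow> nat \<Rightarrow> bool" where
  "generic_submanifold M d \<longleftrightarrow> (\<forall>p\<in>M. \<exists>\<rho>. local_defining_function M d p \<rho>)"


section \<open>CR-vector fields, CR-functions, CR-maps\<close>

text \<open>A CR-vector field on \<open>M \<inter> U\<close> is given by the coefficients \<open>a\<close> of
  \<open>\<Sum>\<^sub>j a\<^sub>j \<partial>/\<partial>Z\<^sup>-\<^sub>j\<close>; tangency means that it annihilates a local defining function (of whatever
  codimension) on \<open>M\<close>.\<close>

definition cr_vector_field_on ::
    "(complex^'n) set \<Rightarrow> (complex^'n) set \<Rightarrow> (complex^'n \<Rightarrow> complex^'n) \<Rightarrow> bool" where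
  "cr_vector_field_on M U a \<longleftrightarrow>
     open U \<and> smooth_on_submanifold a (M \<inter> U) \<and>
     (\<forall>p\<in>M \<inter> U. \<exists>d \<rho>. local_defining_function M d p \<rho> \<and>
        (\<forall>j<d. bar_field UNIV a (\<lambda>Z. complex_of_real (\<rho> j Z)) p = 0))"

definition cr_vector_field_near ::
    "(complex^'n) set \<Rightarrow> complex^'n \<Rightarrow> (complex^'n \<Rightarrow> complex^'n) \<Rightarrow> bool" where
  "cr_vector_field_near M p a \<longleftrightarrow> (\<exists>U. p \<in> U \<and> cr_vector_field_on M U a)"

text \<open>Slice charts: \<open>\<phi>\<close> is a diffeomorphism of open sets which parametrises \<open>M \<inter> \<phi> ` W\<close> by the part
  in \<open>W\<close> of the real coordinate subspace \<open>span B\<close>.\<close>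

definition slice_chart ::
    "(complex^'n) set \<Rightarrow> (complex^'n) set \<Rightarrow> (complex^'n) set \<Rightarrow>
     (complex^'n \<Rightarrow> complex^'n) \<Rightarrow> bool" where
  "slice_chart M B W \<phi> \<longleftrightarrow>
     B \<subseteq> Basis \<and> open W \<and> open (\<phi> ` W) \<and> smooth_on \<phi> W \<and>
     (\<exists>\<psi>. smooth_on \<psi> (\<phi> ` W) \<and> (\<forall>t\<in>W. \<psi> (\<phi> t) = t)) \<and>
     \<phi> ` (W \<inter> span B) = M \<inter> \<phi> ` W"

text \<open>\<open>L u = 0\<close> in the sense of distributions, for \<open>L = \<Sum>\<^sub>j a\<^sub>j \<partial>/\<partial>Z\<^sup>-\<^sub>j\<close> tangent to \<open>M\<close>. In a slice
  chart, \<open>L\<close> is the push-forward of the complex vector field \<open>X = \<Sum>\<^sub>b x\<^sub>b \<partial>/\<partial>t\<^sub>b\<close> on \<open>span B\<close> iff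
  \<open>X \<phi>\<^sub>j = 0\<close> and \<open>X (cnj \<phi>\<^sub>j) = a\<^sub>j \<circ> \<phi>\<close> for all \<open>j\<close>; the formal transpose of \<open>X\<close> maps a test
  function \<open>\<eta>\<close> to \<open>- \<Sum>\<^sub>b \<partial>(x\<^sub>b \<eta>)/\<partial>t\<^sub>b\<close>. Integration is with respect to Lebesgue measure
  on \<open>span B\<close>.\<close>

definition weakly_annihilated ::
    "(complex^'n) set \<Rightarrow> (complex^'n) set \<Rightarrow> (complex^'n \<Rightarrow> complex^'n) \<Rightarrow>
     (complex^'n \<Rightarrow> complex) \<Rightarrow> bool" where
  "weakly_annihilated M U a u \<longleftrightarrow>
     (\<forall>B W \<phi> (x :: complex^'n \<Rightarrow> complex^'n \<Rightarrow> complex) (\<eta> :: complex^'n \<Rightarrow> complex) K.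
        slice_chart M B W \<phi> \<longrightarrow> \<phi> ` W \<subseteq> U \<longrightarrow>
        (\<forall>b\<in>B. smooth_on (x b) W) \<longrightarrow>
        (\<forall>t\<in>W \<inter> span B. \<forall>j.
           (\<Sum>b\<in>B. x b t * frechet_derivative \<phi> (at t) b $ j) = 0 \<and>
           (\<Sum>b\<in>B. x b t * cnj (frechet_derivative \<phi> (at t) b $ j)) = a (\<phi> t) $ j) \<longrightarrow>
        smooth_on \<eta> UNIV \<longrightarrow> compact K \<longrightarrow> K \<subseteq> W \<longrightarrow> (\<forall>t. t \<notin> K \<longrightarrow> \<eta> t = 0) \<longrightarrow>
        integral\<^sup>L (Pi\<^sub>M B (\<lambda>_. lborel :: real measure))
          (\<lambda>s. let t = (\<Sum>b\<in>B. s b *\<^sub>R b) in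
             u (\<phi> t) * (\<Sum>b\<in>B. frechet_derivative (\<lambda>t'. x b t' * \<eta> t') (at t) b)) = 0)"

definition cr_function :: "(complex^'n) set \<Rightarrow> (complex^'n \<Rightarrow> complex) \<Rightarrow> bool" where
  "cr_function M u \<longleftrightarrow>
     (\<forall>U a. cr_vector_field_on M U a \<longrightarrow>
        (if Ck_on_submanifold 1 u M then \<forall>p\<in>M \<inter> U. bar_field M a u p = 0
         else weakly_annihilated M U a u))"

definition cr_map ::
    "nat \<Rightarrow> (complex^'n) set \<Rightarrow> (complex^'m) set \<Rightarrow> (complex^'n \<Rightarrow> complex^'m) \<Rightarrow> bool" where
  "cr_map k M M' H \<longleftrightarrow>
     H ` M \<subseteq> M' \<and> Ck_on_submanifold k H M \<and> (\<forall>i. cr_function M (\<lambda>Z. H Z $ i))"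


section \<open>The spaces \<open>E\<^sub>k(0)\<close>\<close>

text \<open>\<open>\<rho>'\<close> is a defining function of the target manifold near \<open>H 0\<close>, of codimension \<open>d'\<close>. Note that
  \<open>vec.span\<close> is the span over the complex numbers.\<close>

definition E_space ::
    "(complex^'n) set \<Rightarrow> nat \<Rightarrow> (nat \<Rightarrow> complex^'m \<Rightarrow> real) \<Rightarrow> (complex^'n \<Rightarrow> complex^'m) \<Rightarrow> nat \<Rightarrow>
     (complex^'m) set" where
  "E_space M d' \<rho>' H k = vec.span
     {(\<chi> i. foldr (bar_field M) Ls (\<lambda>Z. complex_gradient (\<rho>' l) (H Z) $ i) 0) | Ls l.
        (\<forall>L\<in>set Ls. cr_vector_field_near M 0 L) \<and> length Ls \<le> k \<and> l < d'}"

end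

theory Submission
  imports Defs "HOL-Complex_Analysis.Cauchy_Integral_Formula"
begin

text \<open>
  Why the theorem holds. Put \<open>\<tau> = \<rho>t \<circ> F\<close>. This is a second defining function of \<open>M'\<close> near \<open>0\<close>, and its
  complex gradients satisfy \<open>\<tau>\<^sub>l\<^sub>Z(q) = \<rho>t\<^sub>l\<^sub>Z(F q) J(q)\<close> with \<open>J = \<partial>F/\<partial>Z\<close>. Two facts are combined.

  First, changing the defining function does not change \<open>E\<^sub>k(0)\<close> (lemma \<open>E_space_subset\<close>). On \<open>M'\<close> the
  real differential of each \<open>\<tau>\<^sub>l\<close> vanishes on the tangent space, so \<open>\<tau>\<^sub>l\<^sub>Z = \<Sum>\<^sub>j a\<^sub>l\<^sub>j \<rho>'\<^sub>j\<^sub>Z\<close> there, and the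
  coefficients \<open>a\<^sub>l\<^sub>j\<close> can be chosen smooth by Cramer's rule (\<open>gradient_coefficients\<close>). Composing with
  \<open>H\<close> and applying \<open>L\<^sub>1 \<cdots> L\<^sub>j\<close>, the Leibniz rule expresses the derivatives of \<open>\<tau>\<^sub>l\<^sub>Z\<close> through derivatives
  of the \<open>\<rho>'\<^sub>j\<^sub>Z\<close> of at most the same order (\<open>iterated_bar_field_mult_in_span\<close>). The roles of the two
  defining functions are symmetric.

  Second, passing from \<open>\<rho>t\<close> and \<open>F \<circ> H\<close> to \<open>\<tau>\<close> and \<open>H\<close> multiplies every generator by \<open>J(0)\<close> from the right
  (\<open>E_space_pullback\<close>). The entries of \<open>J\<close> are holomorphic, so those of \<open>J \<circ> H\<close> are annihilated by
  every CR vector field (\<open>bar_field_holomorphic_compose\<close>), and they pass through \<open>L\<^sub>1 \<cdots> L\<^sub>j\<close> like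
  constants (\<open>iterated_bar_field_mult_CR\<close>).

  For these manipulations the derivatives along \<open>M\<close> have to make sense. The Frechet derivative of a
  function within \<open>M\<close> is not unique, but its values on the tangent space are: every vector killed by
  the differential of a defining function is a limit of secants of \<open>M\<close>, by Brouwer's fixed point
  theorem (\<open>tangent_direction_secants\<close>). Hence \<open>L f\<close> may be computed from any local extension of \<open>f\<close>,
  and \<open>L\<close> maps functions of class \<open>C\<^sup>k\<^sup>+\<^sup>1\<close> on \<open>M\<close> to functions of class \<open>C\<^sup>k\<close>
  (\<open>bar_field_eq\<close>, \<open>Ck_on_submanifold_bar_field\<close>). Finally, real-analytic functions and holomorphic maps
  of several variables are smooth, by termwise differentiation of power series and by Cauchy's
  integral formula in one coordinate direction.
\<close>

section \<open>Calculus of functions of class \<open>C\<^sup>k\<close>\<close>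

lemma Ck_on_subset: "Ck_on k f U \<Longrightarrow> V \<subseteq> U \<Longrightarrow> Ck_on k f V"
  by (induction k arbitrary: f) (auto intro: continuous_on_subset)

lemma Ck_on_cong:
  assumes "open U" "\<And>x. x \<in> U \<Longrightarrow> f x = g x" "Ck_on k f U"
  shows "Ck_on k g U"
  using assms
proof (induction k arbitrary: f g)
  case 0
  then show ?case by (auto cong: continuous_on_cong)
next
  case (Suc k)
  have diff: "g differentiable (at x)" if "x \<in> U" for x
  proof -
    obtain D where "(f has_derivative D) (at x)"
      using Suc.prems(3) \<open>x \<in> U\<close> by (auto simp: differentiable_def)
    from has_derivative_transform_within_open[OF this Suc.prems(1) \<open>x \<in> U\<close> Suc.prems(2)]
    show ?thesis by (auto simp: differentiable_def)
  qed
  have eq: "frechet_derivative f (at x) = frechet_derivative g (at x)" if "x \<in> U" for x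
  proof (rule frechet_derivative_transform_within_open[OF _ Suc.prems(1) that Suc.prems(2)])
    show "f differentiable (at x)" using Suc.prems(3) that by simp
  qed
  have "Ck_on k (\<lambda>x. frechet_derivative g (at x) v) U" for v
  proof (rule Suc.IH[OF Suc.prems(1)])
    show "Ck_on k (\<lambda>x. frechet_derivative f (at x) v) U" using Suc.prems(3) by simp
  qed (simp add: eq)
  then show ?case using diff by simp
qed

lemma Ck_on_SucI:
  assumes "open U" "\<And>x. x \<in> U \<Longrightarrow> (f has_derivative D x) (at x)"
    "\<And>v. Ck_on k (\<lambda>x. D x v) U"
  shows "Ck_on (Suc k) f U"
proof -
  have "frechet_derivative f (at x) = D x" if "x \<in> U" for x
    using frechet_derivative_at[OF assms(2)[OF that]] by simp
  then have "Ck_on k (\<lambda>x. frechet_derivative f (at x) v) U" for v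
    by (intro Ck_on_cong[OF assms(1) _ assms(3)[of v]]) simp
  then show ?thesis using assms(2) by (auto simp: differentiable_def)
qed

lemma Ck_on_Suc_has_derivative:
  "Ck_on (Suc k) f U \<Longrightarrow> x \<in> U \<Longrightarrow> (f has_derivative frechet_derivative f (at x)) (at x)"
  using frechet_derivative_works by auto

lemma Ck_on_decr_Suc: "Ck_on (Suc k) f U \<Longrightarrow> Ck_on k f U"
proof (induction k arbitrary: f)
  case 0
  then show ?case
    by (auto intro!: differentiable_imp_continuous_on differentiable_at_imp_differentiable_on)
next
  case (Suc k)
  then show ?case by (metis Ck_on.simps(2))
qed

lemma Ck_on_decr: "Ck_on k f U \<Longrightarrow> j \<le> k \<Longrightarrow> Ck_on j f U"
proof (induction k)
  case (Suc k)
  then show ?case using Ck_on_decr_Suc by (metis le_Suc_eq)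
qed auto

lemma Ck_on_continuous: "Ck_on k f U \<Longrightarrow> continuous_on U f"
  using Ck_on_decr[of k f U 0] by simp

lemma Ck_on_const: "Ck_on k (\<lambda>x. c) U"
  by (induction k arbitrary: c) auto

lemma Ck_on_bounded_linear:
  assumes "open U" "bounded_linear L" "Ck_on k f U"
  shows "Ck_on k (\<lambda>x. L (f x)) U"
  using assms(3)
proof (induction k arbitrary: f)
  case 0
  then show ?case using assms(2) by (auto intro: bounded_linear.continuous_on)
next
  case (Suc k)
  show ?case
  proof (rule Ck_on_SucI[OF assms(1)])
    show "((\<lambda>x. L (f x)) has_derivative (\<lambda>v. L (frechet_derivative f (at x) v))) (at x)"
      if "x \<in> U" for x
      using bounded_linear.has_derivative[OF assms(2) Ck_on_Suc_has_derivative[OF Suc.prems that]] .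
  qed (use Suc in auto)
qed

lemma Ck_on_id: "open U \<Longrightarrow> Ck_on k (\<lambda>x. x) U"
  by (cases k) (use Ck_on_SucI[OF _ has_derivative_ident Ck_on_const] in auto)

lemma Ck_on_add:
  assumes "open U" "Ck_on k f U" "Ck_on k g U"
  shows "Ck_on k (\<lambda>x. f x + g x) U"
  using assms(2,3)
proof (induction k arbitrary: f g)
  case 0
  then show ?case by (auto intro: continuous_on_add)
next
  case (Suc k)
  show ?case
  proof (rule Ck_on_SucI[OF assms(1)])
    show "((\<lambda>x. f x + g x) has_derivative
        (\<lambda>v. frechet_derivative f (at x) v + frechet_derivative g (at x) v)) (at x)"
      if "x \<in> U" for x
      using Suc.prems that by (intro has_derivative_add Ck_on_Suc_has_derivative)
  qed (use Suc in auto)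
qed

lemma Ck_on_sum:
  assumes "open U" "\<And>i. i \<in> I \<Longrightarrow> Ck_on k (f i) U"
  shows "Ck_on k (\<lambda>x. \<Sum>i\<in>I. f i x) U"
  using assms(2)
proof (induction I rule: infinite_finite_induct)
  case (insert i I)
  show ?case using Ck_on_add[OF assms(1), of k "f i" "\<lambda>x. \<Sum>i\<in>I. f i x"] insert by simp
qed (simp_all add: Ck_on_const)

lemma Ck_on_bilinear:
  assumes "bounded_bilinear p" "open U" "Ck_on k f U" "Ck_on k g U"
  shows "Ck_on k (\<lambda>x. p (f x) (g x)) U"
  using assms(3,4)
proof (induction k arbitrary: f g)
  case 0
  then show ?case using assms(1) by (auto intro: bounded_bilinear.continuous_on)
next
  case (Suc k)
  show ?case
  proof (rule Ck_on_SucI[OF assms(2)])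
    show "((\<lambda>x. p (f x) (g x)) has_derivative
        (\<lambda>v. p (f x) (frechet_derivative g (at x) v) + p (frechet_derivative f (at x) v) (g x))) (at x)"
      if "x \<in> U" for x
      using Suc.prems that
      by (intro bounded_bilinear.FDERIV[OF assms(1)] Ck_on_Suc_has_derivative)
    show "Ck_on k (\<lambda>x. p (f x) (frechet_derivative g (at x) v)
        + p (frechet_derivative f (at x) v) (g x)) U" for v
      using Suc.prems
      by (intro Ck_on_add[OF assms(2)] Suc.IH Ck_on_decr_Suc[OF Suc.prems(1)]
          Ck_on_decr_Suc[OF Suc.prems(2)]) simp_all
  qed
qed

lemmas Ck_on_mult = Ck_on_bilinear[OF bounded_bilinear_mult]

lemma Ck_on_prod:
  fixes f :: "'i \<Rightarrow> 'a::euclidean_space \<Rightarrow> 'b::real_normed_field"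
  assumes "open U" "\<And>i. i \<in> I \<Longrightarrow> Ck_on k (f i) U"
  shows "Ck_on k (\<lambda>x. \<Prod>i\<in>I. f i x) U"
  using assms(2)
proof (induction I rule: infinite_finite_induct)
  case (insert i I)
  show ?case using Ck_on_mult[OF assms(1), of k "f i" "\<lambda>x. \<Prod>i\<in>I. f i x"] insert by simp
qed (simp_all add: Ck_on_const)

lemma Ck_on_inverse:
  fixes f :: "'a::euclidean_space \<Rightarrow> 'b::real_normed_field"
  assumes "open U" "Ck_on k f U" "\<And>x. x \<in> U \<Longrightarrow> f x \<noteq> 0"
  shows "Ck_on k (\<lambda>x. inverse (f x)) U"
  using assms(2)
proof (induction k)
  case 0
  then show ?case using assms(3) by (auto intro!: continuous_on_inverse)
next
  case (Suc k)
  have inv: "Ck_on k (\<lambda>x. inverse (f x)) U"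
    by (rule Suc.IH[OF Ck_on_decr_Suc[OF Suc.prems]])
  show ?case
  proof (rule Ck_on_SucI[OF assms(1)])
    show "((\<lambda>x. inverse (f x)) has_derivative
        (\<lambda>v. (-1) * (inverse (f x) * frechet_derivative f (at x) v * inverse (f x)))) (at x)"
      if "x \<in> U" for x
      using Deriv.has_derivative_inverse[OF assms(3)[OF that] Ck_on_Suc_has_derivative[OF Suc.prems that]]
      by simp
    show "Ck_on k (\<lambda>x. (-1) * (inverse (f x) * frechet_derivative f (at x) v * inverse (f x))) U"
      for v
      using Suc.prems by (intro Ck_on_mult[OF assms(1)] inv Ck_on_const) simp
  qed
qed

text \<open>By the chain rule, with the inner derivative expanded in the basis, a directional derivative of
  the composite is a sum of products \<open>(D\<^sub>v g \<bullet> b) \<cdot> (D\<^sub>b f \<circ> g)\<close>. The second factor is again a composite with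
  the same inner function, so the induction runs over all outer functions at once.\<close>

lemma Ck_on_compose:
  fixes f :: "'b::euclidean_space \<Rightarrow> 'c::real_normed_vector"
    and g :: "'a::euclidean_space \<Rightarrow> 'b"
  assumes "open U" "open V" "g ` U \<subseteq> V" "Ck_on k g U" "Ck_on k f V"
  shows "Ck_on k (\<lambda>x. f (g x)) U"
  using assms(4,5)
proof (induction k arbitrary: f)
  case 0
  then show ?case using assms(3) by (auto intro: continuous_on_compose2)
next
  case (Suc k)
  let ?Df = "\<lambda>y. frechet_derivative f (at y)" and ?Dg = "\<lambda>x. frechet_derivative g (at x)"
  have Dg: "(g has_derivative ?Dg x) (at x)" if "x \<in> U" for x
    using Suc.prems(1) that by (rule Ck_on_Suc_has_derivative)
  have Df: "(f has_derivative ?Df (g x)) (at (g x))" if "x \<in> U" for x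
    using Suc.prems(2) that assms(3) by (intro Ck_on_Suc_has_derivative) auto
  have expand: "?Df (g x) (?Dg x v) = (\<Sum>b\<in>Basis. (?Dg x v \<bullet> b) *\<^sub>R ?Df (g x) b)"
    if "x \<in> U" for x v
  proof -
    interpret linear "?Df (g x)" using Df[OF that] has_derivative_linear by blast
    have "?Df (g x) (?Dg x v) = ?Df (g x) (\<Sum>b\<in>Basis. (?Dg x v \<bullet> b) *\<^sub>R b)"
      by (simp add: euclidean_representation)
    then show ?thesis by (simp only: sum scale)
  qed
  show ?case
  proof (rule Ck_on_SucI[OF assms(1)])
    show "((\<lambda>x. f (g x)) has_derivative
        (\<lambda>v. \<Sum>b\<in>Basis. (?Dg x v \<bullet> b) *\<^sub>R ?Df (g x) b)) (at x)" if "x \<in> U" for x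
      using has_derivative_compose[OF Dg Df, OF that that] expand[OF that] by simp
    have "Ck_on k (\<lambda>x. ?Df (g x) b) U" for b
      using Suc.prems(2) by (intro Suc.IH Ck_on_decr_Suc[OF Suc.prems(1)]) simp
    moreover have "Ck_on k (\<lambda>x. ?Dg x v \<bullet> b) U" for v b
      using Suc.prems(1) by (intro Ck_on_bounded_linear[OF assms(1) bounded_linear_inner_left]) auto
    ultimately show "Ck_on k (\<lambda>x. \<Sum>b\<in>Basis. (?Dg x v \<bullet> b) *\<^sub>R ?Df (g x) b) U" for v
      by (intro Ck_on_sum[OF assms(1)] Ck_on_bilinear[OF bounded_bilinear_scaleR assms(1)])
  qed
qed

lemma Ck_on_vec_nth:
  fixes f :: "'a::euclidean_space \<Rightarrow> ('b::euclidean_space)^'m"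
  shows "open U \<Longrightarrow> Ck_on k f U \<Longrightarrow> Ck_on k (\<lambda>x. f x $ i) U"
  by (rule Ck_on_bounded_linear[OF _ bounded_linear_vec_nth])

lemma bounded_linear_axis: "bounded_linear (axis i :: complex \<Rightarrow> complex^'m)"
proof (rule linear_conv_bounded_linear[THEN iffD1, OF linearI])
  show "axis i (x + y) = (axis i x + axis i y :: complex^'m)" for x y :: complex
    by (simp add: vec_eq_iff axis_def)
  show "axis i (r *\<^sub>R x) = (r *\<^sub>R axis i x :: complex^'m)" for r and x :: complex
    by (simp add: vec_eq_iff axis_def)
qed

lemma Ck_on_vecI:
  fixes f :: "'a::euclidean_space \<Rightarrow> complex^'m"
  assumes "open U" "\<And>i. Ck_on k (\<lambda>x. f x $ i) U"
  shows "Ck_on k f U"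
proof -
  have "Ck_on k (\<lambda>x. axis i (f x $ i) :: complex^'m) U" for i
    by (rule Ck_on_bounded_linear[OF assms(1) bounded_linear_axis assms(2)])
  then have *: "Ck_on k (\<lambda>x. \<Sum>i\<in>UNIV. axis i (f x $ i) :: complex^'m) U"
    by (rule Ck_on_sum[OF assms(1)])
  have "(\<Sum>i\<in>UNIV. axis i (f x $ i)) = f x" for x
    unfolding vec_eq_iff axis_def sum_component by (simp add: sum.delta)
  then show ?thesis using * by simp
qed

lemma Ck_on_det:
  fixes A :: "'a::euclidean_space \<Rightarrow> complex^'m^'m"
  assumes "open U" "\<And>i j. Ck_on k (\<lambda>x. A x $ i $ j) U"
  shows "Ck_on k (\<lambda>x. det (A x)) U"
proof -
  have "Ck_on k (\<lambda>x. \<Prod>i\<in>UNIV. A x $ i $ p i) U" for p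
    by (rule Ck_on_prod[OF assms(1) assms(2)])
  then have "Ck_on k (\<lambda>x. of_int (sign p) * (\<Prod>i\<in>UNIV. A x $ i $ p i)) U" for p
    by (rule Ck_on_mult[OF assms(1) Ck_on_const])
  then show ?thesis unfolding det_def by (rule Ck_on_sum[OF assms(1)])
qed

section \<open>Real-analytic functions are smooth\<close>

abbreviation multi_indices :: "('a::euclidean_space \<Rightarrow> nat) set" where
  "multi_indices \<equiv> Basis \<rightarrow>\<^sub>E (UNIV :: nat set)"

definition monomial :: "('a::euclidean_space \<Rightarrow> nat) \<Rightarrow> 'a \<Rightarrow> real" where
  "monomial \<alpha> h = (\<Prod>b\<in>Basis. (h \<bullet> b) ^ \<alpha> b)"

text \<open>The partial derivative of a monomial in the direction \<open>b\<close>; for \<open>\<alpha> b = 0\<close> the truncated exponent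
  is harmless because of the factor \<open>\<alpha> b\<close>.\<close>

definition monomial_deriv :: "'a::euclidean_space \<Rightarrow> ('a \<Rightarrow> nat) \<Rightarrow> 'a \<Rightarrow> real" where
  "monomial_deriv b \<alpha> h =
     real (\<alpha> b) * (h \<bullet> b) ^ (\<alpha> b - 1) * (\<Prod>b'\<in>Basis - {b}. (h \<bullet> b') ^ \<alpha> b')"

lemma has_derivative_monomial:
  "((\<lambda>x. monomial \<alpha> (x - p)) has_derivative
     (\<lambda>v. \<Sum>b\<in>Basis. (v \<bullet> b) * monomial_deriv b \<alpha> (x - p))) (at x within S)"
proof -
  have "((\<lambda>x. ((x - p) \<bullet> b) ^ \<alpha> b) has_derivative
      (\<lambda>v. real (\<alpha> b) * (v \<bullet> b) * ((x - p) \<bullet> b) ^ (\<alpha> b - 1))) (at x within S)" for b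
    by (rule derivative_eq_intros refl)+ (simp add: algebra_simps)
  then have "((\<lambda>x. \<Prod>b\<in>Basis. ((x - p) \<bullet> b) ^ \<alpha> b) has_derivative
      (\<lambda>v. \<Sum>b\<in>Basis. real (\<alpha> b) * (v \<bullet> b) * ((x - p) \<bullet> b) ^ (\<alpha> b - 1) *
        (\<Prod>b'\<in>Basis - {b}. ((x - p) \<bullet> b') ^ \<alpha> b'))) (at x within S)"
    by (rule has_derivative_prod)
  then show ?thesis
    unfolding monomial_def monomial_deriv_def by (simp add: mult_ac)
qed

text \<open>The factor \<open>\<alpha> b\<close> produced by differentiation is absorbed by doubling the radius, since
  \<open>n \<le> 2 ^ n\<close>. This gives a majorant of the differentiated series that is a multiple of the original one.\<close>

lemma abs_monomial_deriv_le:
  assumes "s > 0" "\<And>b. b \<in> Basis \<Longrightarrow> \<bar>h \<bullet> b\<bar> \<le> s" "b \<in> Basis"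
  shows "\<bar>monomial_deriv b \<alpha> h\<bar> \<le> (\<Prod>b\<in>Basis. (2 * s) ^ \<alpha> b) / s"
proof -
  have "real (\<alpha> b) * \<bar>h \<bullet> b\<bar> ^ (\<alpha> b - 1) \<le> (2 * s) ^ \<alpha> b / s"
  proof (cases "\<alpha> b")
    case (Suc n)
    have "real (Suc n) * \<bar>h \<bullet> b\<bar> ^ n \<le> 2 ^ Suc n * s ^ n"
      using assms of_nat_less_two_power[of "Suc n", where 'a = real]
      by (intro mult_mono power_mono) auto
    then show ?thesis
      using Suc assms(1) by (simp add: power_mult_distrib)
  qed (use assms in auto)
  moreover have "(\<Prod>b'\<in>Basis - {b}. \<bar>h \<bullet> b'\<bar> ^ \<alpha> b') \<le> (\<Prod>b'\<in>Basis - {b}. (2 * s) ^ \<alpha> b')"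
  proof (intro prod_mono conjI power_mono)
    show "\<bar>h \<bullet> b'\<bar> \<le> 2 * s" if "b' \<in> Basis - {b}" for b'
      using assms(1) assms(2)[of b'] that by simp
  qed auto
  ultimately have "real (\<alpha> b) * \<bar>h \<bullet> b\<bar> ^ (\<alpha> b - 1) * (\<Prod>b'\<in>Basis - {b}. \<bar>h \<bullet> b'\<bar> ^ \<alpha> b')
      \<le> (2 * s) ^ \<alpha> b / s * (\<Prod>b'\<in>Basis - {b}. (2 * s) ^ \<alpha> b')"
    using assms(1) by (intro mult_mono) (auto intro!: prod_nonneg)
  also have "\<dots> = (\<Prod>b\<in>Basis. (2 * s) ^ \<alpha> b) / s"
    using assms(3) by (simp add: prod.remove[of Basis b])
  finally show ?thesis
    by (simp add: monomial_deriv_def abs_mult power_abs abs_prod)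
qed

text \<open>Shifting the exponent of \<open>b\<close> by one turns the differentiated series back into a power series, so
  that differentiation can be iterated.\<close>

lemma has_sum_monomial_deriv:
  assumes "b \<in> Basis"
    and "((\<lambda>\<alpha>. c \<alpha> * monomial_deriv b \<alpha> h) has_sum S) multi_indices"
  shows "((\<lambda>\<beta>. c (\<beta>(b := Suc (\<beta> b))) * real (Suc (\<beta> b)) * monomial \<beta> h) has_sum S) multi_indices"
proof -
  let ?up = "\<lambda>\<beta>. \<beta>(b := Suc (\<beta> b))" and ?J = "{\<alpha> \<in> multi_indices. \<alpha> b > 0}"
  have bij: "bij_betw ?up multi_indices ?J"
  proof (rule bij_betw_byWitness[where f' = "\<lambda>\<alpha>. \<alpha>(b := \<alpha> b - 1)"])
    show "?up ` multi_indices \<subseteq> ?J"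
      using assms(1) by (auto simp: PiE_def extensional_def)
    show "(\<lambda>\<alpha>. \<alpha>(b := \<alpha> b - 1)) ` ?J \<subseteq> multi_indices"
      using assms(1) by (auto simp: PiE_def extensional_def)
  qed auto
  have "((\<lambda>\<alpha>. c \<alpha> * monomial_deriv b \<alpha> h) has_sum S) ?J"
    by (rule has_sum_cong_neutral[THEN iffD1, OF _ _ _ assms(2)]) (auto simp: monomial_deriv_def)
  then have "((\<lambda>\<beta>. c (?up \<beta>) * monomial_deriv b (?up \<beta>) h) has_sum S) multi_indices"
    by (subst has_sum_reindex_bij_betw[OF bij, where f = "\<lambda>\<alpha>. c \<alpha> * monomial_deriv b \<alpha> h"])
  moreover have "monomial_deriv b (?up \<beta>) h = real (Suc (\<beta> b)) * monomial \<beta> h" for \<beta>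
    using assms(1) by (simp add: monomial_deriv_def monomial_def prod.remove[of Basis b])
  ultimately show ?thesis by (simp only: mult.assoc)
qed

lemma infinite_countable_multi_indices:
  "infinite (multi_indices :: ('a::euclidean_space \<Rightarrow> nat) set)"
  "countable (multi_indices :: ('a::euclidean_space \<Rightarrow> nat) set)"
proof -
  obtain b :: 'a where b: "b \<in> Basis" using SOME_Basis by (rule that)
  have "inj (\<lambda>n. (\<lambda>x\<in>Basis :: 'a set. n :: nat))"
  proof (rule injI)
    fix n k assume "(\<lambda>x\<in>Basis :: 'a set. n :: nat) = (\<lambda>x\<in>Basis. k)"
    from fun_cong[OF this, of b] show "n = k" using b by simp
  qed
  moreover have "range (\<lambda>n. (\<lambda>x\<in>Basis :: 'a set. n :: nat)) \<subseteq> multi_indices" by auto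
  ultimately show "infinite (multi_indices :: ('a \<Rightarrow> nat) set)"
    using infinite_iff_countable_subset by blast
  show "countable (multi_indices :: ('a \<Rightarrow> nat) set)"
    by (rule countable_PiE) auto
qed

text \<open>Termwise differentiation on a smaller ball: the series of derivatives has a summable majorant
  (\<open>abs_monomial_deriv_le\<close>), hence converges uniformly, and after an enumeration of the multi-indices
  the theorem on differentiating series applies.\<close>

lemma has_derivative_multi_power_series:
  fixes f :: "'a::euclidean_space \<Rightarrow> real"
  assumes "r > 0"
    and series: "\<And>x. x \<in> ball p r \<Longrightarrow> ((\<lambda>\<alpha>. c \<alpha> * monomial \<alpha> (x - p)) has_sum f x) multi_indices"
  shows "\<exists>s>0. \<exists>G. \<forall>x\<in>ball p s.
    (f has_derivative (\<lambda>v. \<Sum>b\<in>Basis. (v \<bullet> b) * G b (x - p))) (at x) \<and>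
    (\<forall>b\<in>Basis. ((\<lambda>\<alpha>. c \<alpha> * monomial_deriv b \<alpha> (x - p)) has_sum G b (x - p)) multi_indices)"
proof -
  \<comment> \<open>The cube of half-width \<open>2 s\<close> lies in the ball of radius \<open>r\<close>, so the series converges at its corner.\<close>
  define s where "s = r / (4 * real DIM('a))"
  have s: "0 < s" "s \<le> r" "2 * s * real DIM('a) < r"
  proof -
    have d: "real DIM('a) \<ge> 1" using DIM_positive[where 'a = 'a] by linarith
    show "0 < s" using assms(1) d by (simp add: s_def)
    have "r * 1 \<le> r * (4 * real DIM('a))" using assms(1) d by (intro mult_left_mono) linarith+
    then show "s \<le> r" using d by (simp add: s_def divide_le_eq)
    show "2 * s * real DIM('a) < r" using assms(1) d by (simp add: s_def)
  qed
  define M where "M \<alpha> = \<bar>c \<alpha>\<bar> * ((\<Prod>b\<in>Basis. (2 * s) ^ \<alpha> b) / s)" for \<alpha> :: "'a \<Rightarrow> nat"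
  have M: "M summable_on multi_indices"
  proof -
    define h :: 'a where "h = (\<Sum>b\<in>Basis. (2 * s) *\<^sub>R b)"
    have hb: "h \<bullet> b = 2 * s" if "b \<in> Basis" for b
      using that by (simp add: h_def inner_sum_left inner_Basis if_distrib sum.delta cong: if_cong)
    have "norm h \<le> (\<Sum>b\<in>Basis. norm ((2 * s) *\<^sub>R b :: 'a))"
      unfolding h_def by (rule norm_sum)
    also have "\<dots> = 2 * s * real DIM('a)" using s by simp
    also have "\<dots> < r" by (rule s)
    finally have "p + h \<in> ball p r" by (simp add: dist_norm)
    from series[OF this]
    have "(\<lambda>\<alpha>. c \<alpha> * monomial \<alpha> h) summable_on multi_indices"
      by (auto simp: summable_on_def)
    then have "(\<lambda>\<alpha>. norm (c \<alpha> * monomial \<alpha> h)) summable_on multi_indices"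
      by (rule summable_on_iff_abs_summable_on_real[THEN iffD1])
    then have "(\<lambda>\<alpha>. norm (c \<alpha> * monomial \<alpha> h) * (1 / s)) summable_on multi_indices"
      by (rule summable_on_cmult_left)
    moreover have "norm (c \<alpha> * monomial \<alpha> h) * (1 / s) = M \<alpha>" for \<alpha>
      using s(1) by (simp add: M_def monomial_def hb abs_mult abs_prod power_abs)
    ultimately show ?thesis by simp
  qed
  have coord: "\<bar>(x - p) \<bullet> b\<bar> \<le> s" if "x \<in> ball p s" "b \<in> Basis" for x b
    using that Basis_le_norm[of b "x - p"] by (simp add: dist_norm norm_minus_commute)
  have dom: "\<bar>c \<alpha> * monomial_deriv b \<alpha> (x - p)\<bar> \<le> M \<alpha>" if "x \<in> ball p s" "b \<in> Basis" for x b \<alpha>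
    unfolding M_def abs_mult
    by (intro mult_left_mono abs_monomial_deriv_le s coord[OF that(1)] that(2)) auto
  define G where "G b h = infsum (\<lambda>\<alpha>. c \<alpha> * monomial_deriv b \<alpha> h) multi_indices" for b h :: 'a
  have G: "((\<lambda>\<alpha>. c \<alpha> * monomial_deriv b \<alpha> (x - p)) has_sum G b (x - p)) multi_indices"
    if "x \<in> ball p s" "b \<in> Basis" for x b
  proof -
    have "norm (c \<alpha> * monomial_deriv b \<alpha> (x - p)) \<le> norm (M \<alpha>)" for \<alpha>
      using dom[OF that, of \<alpha>] by simp
    then have "(\<lambda>\<alpha>. norm (c \<alpha> * monomial_deriv b \<alpha> (x - p))) summable_on multi_indices"
      by (rule Infinite_Sum.abs_summable_on_comparison_test[OF
            summable_on_iff_abs_summable_on_real[THEN iffD1, OF M]])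
    then have "(\<lambda>\<alpha>. c \<alpha> * monomial_deriv b \<alpha> (x - p)) summable_on multi_indices"
      by (rule summable_on_iff_abs_summable_on_real[THEN iffD2])
    then show ?thesis unfolding G_def by (rule has_sum_infsum)
  qed
  define e where "e = from_nat_into (multi_indices :: ('a \<Rightarrow> nat) set)"
  have e: "bij_betw e UNIV multi_indices"
    unfolding e_def
    by (rule bij_betw_from_nat_into[OF infinite_countable_multi_indices(2,1)])
  have reindex: "(\<lambda>n. u (e n)) sums S" if "(u has_sum S) multi_indices" for u :: "_ \<Rightarrow> real" and S
    using that has_sum_reindex_bij_betw[OF e, of u] by (intro has_sum_imp_sums) simp
  have "summable (\<lambda>n. M (e n))"
    using reindex M by (auto simp: summable_on_def summable_def)
  then have unif: "uniform_limit (ball p s) (\<lambda>n x. \<Sum>i<n. c (e i) * monomial_deriv b (e i) (x - p))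
      (\<lambda>x. G b (x - p)) sequentially" if "b \<in> Basis" for b
  proof -
    have G_eq: "(\<Sum>i. c (e i) * monomial_deriv b (e i) (x - p)) = G b (x - p)"
      if "x \<in> ball p s" for x
      using reindex[OF G[OF that \<open>b \<in> Basis\<close>]] by (rule sums_unique[symmetric])
    have "uniform_limit (ball p s) (\<lambda>n x. \<Sum>i<n. c (e i) * monomial_deriv b (e i) (x - p))
        (\<lambda>x. \<Sum>i. c (e i) * monomial_deriv b (e i) (x - p)) sequentially"
      using dom that \<open>summable (\<lambda>n. M (e n))\<close> by (intro Weierstrass_m_test) auto
    then show ?thesis
      unfolding uniform_limit_iff by (simp only: G_eq cong: ball_cong)
  qed
  let ?f' = "\<lambda>n x v. c (e n) * (\<Sum>b\<in>Basis. (v \<bullet> b) * monomial_deriv b (e n) (x - p))"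
  let ?g' = "\<lambda>x v. \<Sum>b\<in>Basis. (v \<bullet> b) * G b (x - p)"
  have "\<exists>g. \<forall>x\<in>ball p s. (\<lambda>n. c (e n) * monomial (e n) (x - p)) sums g x \<and>
      (g has_derivative ?g' x) (at x within ball p s)"
  proof (rule has_derivative_series)
    show "((\<lambda>x. c (e n) * monomial (e n) (x - p)) has_derivative ?f' n x) (at x within ball p s)"
      for n x
      by (intro has_derivative_mult_right has_derivative_monomial)
    show "\<forall>\<^sub>F n in sequentially. \<forall>x\<in>ball p s. \<forall>v.
        norm ((\<Sum>i<n. ?f' i x v) - ?g' x v) \<le> \<epsilon> * norm v" if "\<epsilon> > 0" for \<epsilon>
    proof -
      define \<delta> where "\<delta> = \<epsilon> / real DIM('a)"
      have \<delta>: "\<delta> > 0" "\<delta> * real DIM('a) = \<epsilon>"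
        using that DIM_positive[where 'a = 'a] by (auto simp: \<delta>_def)
      have "\<forall>\<^sub>F n in sequentially. \<forall>b\<in>Basis. \<forall>x\<in>ball p s.
          dist (\<Sum>i<n. c (e i) * monomial_deriv b (e i) (x - p)) (G b (x - p)) < \<delta>"
        using unif \<delta> by (intro eventually_ball_finite) (auto simp: uniform_limit_iff)
      then show ?thesis
      proof eventually_elim
        case (elim n)
        show ?case
        proof (intro ballI allI)
          fix x v :: 'a assume x: "x \<in> ball p s"
          let ?S = "\<lambda>b. \<Sum>i<n. c (e i) * monomial_deriv b (e i) (x - p)"
          have "(\<Sum>i<n. ?f' i x v) = (\<Sum>b\<in>Basis. (v \<bullet> b) * ?S b)"
            by (simp add: sum_distrib_left) (subst sum.swap, simp add: mult_ac)
          then have "norm ((\<Sum>i<n. ?f' i x v) - ?g' x v)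
              = \<bar>\<Sum>b\<in>Basis. (v \<bullet> b) * (?S b - G b (x - p))\<bar>"
            by (simp add: sum_subtractf[symmetric] right_diff_distrib)
          also have "\<dots> \<le> (\<Sum>b\<in>(Basis :: 'a set). norm v * \<delta>)"
          proof (intro order.trans[OF sum_abs] sum_mono)
            fix b :: 'a assume b: "b \<in> Basis"
            have "\<bar>?S b - G b (x - p)\<bar> \<le> \<delta>" using elim b x by (auto simp: dist_real_def less_imp_le)
            then show "\<bar>(v \<bullet> b) * (?S b - G b (x - p))\<bar> \<le> norm v * \<delta>"
              unfolding abs_mult using Basis_le_norm[OF b, of v] by (intro mult_mono) auto
          qed
          also have "\<dots> = \<epsilon> * norm v" using \<delta>(2) by (simp add: mult_ac)
          finally show "norm ((\<Sum>i<n. ?f' i x v) - ?g' x v) \<le> \<epsilon> * norm v" .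
        qed
      qed
    qed
    show "p \<in> ball p s" using s by simp
    show "(\<lambda>n. c (e n) * monomial (e n) (p - p)) sums f p"
      using reindex[OF series[of p]] assms(1) by simp
  qed simp
  then obtain g where g: "\<And>x. x \<in> ball p s \<Longrightarrow> (\<lambda>n. c (e n) * monomial (e n) (x - p)) sums g x"
      "\<And>x. x \<in> ball p s \<Longrightarrow> (g has_derivative ?g' x) (at x within ball p s)" by blast
  have gf: "g x = f x" if "x \<in> ball p s" for x
    using sums_unique2[OF g(1)[OF that] reindex[OF series[of x]]] that s(2) by simp
  have "(f has_derivative ?g' x) (at x)" if "x \<in> ball p s" for x
  proof (rule has_derivative_transform_within_open[OF _ open_ball that gf])
    show "(g has_derivative ?g' x) (at x)"
      using g(2)[OF that] at_within_open[OF that open_ball] by simp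
  qed
  then show ?thesis
    by (intro exI[of _ s] conjI s(1) exI[of _ G] ballI G)
qed

lemma has_sum_finite_sum:
  fixes u :: "'i \<Rightarrow> 'j \<Rightarrow> real"
  assumes "\<And>i. i \<in> I \<Longrightarrow> (u i has_sum (S i)) A"
  shows "((\<lambda>a. \<Sum>i\<in>I. u i a) has_sum sum S I) A"
  using assms
proof (induction I rule: infinite_finite_induct)
  case (insert i I)
  then show ?case using has_sum_add[of "u i" A "S i"] by simp
qed simp_all

text \<open>The directional derivatives of a real-analytic function are real-analytic; smoothness then
  follows by induction on the order.\<close>

lemma real_analytic_imp_derivative:
  fixes f :: "'a::euclidean_space \<Rightarrow> real"
  assumes "real_analytic_on f U"
  shows "x \<in> U \<Longrightarrow> f differentiable (at x)"
    and "real_analytic_on (\<lambda>x. frechet_derivative f (at x) v) U"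
proof -
  have local: "\<exists>s>0. \<exists>c'. \<forall>x\<in>ball p s. f differentiable (at x) \<and>
      ((\<lambda>\<alpha>. c' \<alpha> * monomial \<alpha> (x - p)) has_sum frechet_derivative f (at x) v) multi_indices"
    if p: "p \<in> U" for p v
  proof -
    from assms[unfolded real_analytic_on_def monomial_def[symmetric], THEN bspec, OF p]
    obtain r c where "r > 0" and
      "\<forall>x\<in>ball p r. ((\<lambda>\<alpha>. c \<alpha> * monomial \<alpha> (x - p)) has_sum f x) multi_indices"
      by (elim exE bexE conjE)
    from has_derivative_multi_power_series[OF \<open>r > 0\<close> bspec[OF this(2)]]
    obtain s G where s: "0 < s" and DG: "\<forall>x\<in>ball p s.
        (f has_derivative (\<lambda>v. \<Sum>b\<in>Basis. (v \<bullet> b) * G b (x - p))) (at x) \<and>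
        (\<forall>b\<in>Basis. ((\<lambda>\<alpha>. c \<alpha> * monomial_deriv b \<alpha> (x - p)) has_sum G b (x - p)) multi_indices)"
      by auto
    note D = DG[THEN bspec, THEN conjunct1]
    note G = DG[THEN bspec, THEN conjunct2, THEN bspec]
    let ?c' = "\<lambda>\<beta>. \<Sum>b\<in>Basis. (v \<bullet> b) * (c (\<beta>(b := Suc (\<beta> b))) * real (Suc (\<beta> b)))"
    have "((\<lambda>\<beta>. ?c' \<beta> * monomial \<beta> (x - p)) has_sum frechet_derivative f (at x) v) multi_indices"
      if x: "x \<in> ball p s" for x
    proof -
      have "((\<lambda>\<beta>. \<Sum>b\<in>Basis. (v \<bullet> b) * (c (\<beta>(b := Suc (\<beta> b))) * real (Suc (\<beta> b)) *
          monomial \<beta> (x - p))) has_sum (\<Sum>b\<in>Basis. (v \<bullet> b) * G b (x - p))) multi_indices"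
        by (intro has_sum_finite_sum has_sum_cmult_right has_sum_monomial_deriv G x)
      then show ?thesis
        using frechet_derivative_at[OF D[OF x], symmetric]
        by (simp add: sum_distrib_right mult.assoc)
    qed
    moreover have "f differentiable (at x)" if "x \<in> ball p s" for x
      using D[OF that] by (rule differentiableI)
    ultimately show ?thesis
      by (intro exI[of _ s] exI[of _ ?c'] conjI s ballI)
  qed
  show "f differentiable (at x)" if "x \<in> U" using local[OF that] by (metis centre_in_ball)
  show "real_analytic_on (\<lambda>x. frechet_derivative f (at x) v) U"
    unfolding real_analytic_on_def monomial_def[symmetric]
  proof
    fix p assume "p \<in> U"
    from local[OF this, of v] obtain s c' where "s > 0" "\<forall>x\<in>ball p s. f differentiable (at x) \<and>
        ((\<lambda>\<alpha>. c' \<alpha> * monomial \<alpha> (x - p)) has_sum frechet_derivative f (at x) v) multi_indices"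
      by (elim exE conjE)
    then show "\<exists>s>0. \<exists>c'. \<forall>x\<in>ball p s.
        ((\<lambda>\<alpha>. c' \<alpha> * monomial \<alpha> (x - p)) has_sum frechet_derivative f (at x) v) multi_indices"
      by blast
  qed
qed

lemma real_analytic_imp_smooth: "real_analytic_on f U \<Longrightarrow> smooth_on f U"
proof -
  have "Ck_on k f U" if "real_analytic_on f U" for k
    using that
  proof (induction k arbitrary: f)
    case 0
    then show ?case
      using real_analytic_imp_derivative(1)
      by (auto intro!: differentiable_imp_continuous_on differentiable_at_imp_differentiable_on)
  next
    case (Suc k)
    show ?case
      using real_analytic_imp_derivative(1)[OF Suc.prems]
        Suc.IH[OF real_analytic_imp_derivative(2)[OF Suc.prems]] by simp
  qed
  then show "real_analytic_on f U \<Longrightarrow> smooth_on f U" by (simp add: smooth_on_def)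
qed

section \<open>Holomorphic maps of several variables are smooth\<close>

text \<open>Frechet differentiability with a complex-linear derivative. The coefficients are written as
  Wirtinger derivatives because these are the functions to be differentiated again.\<close>

definition holomorphic_fun_on :: "(complex^'m \<Rightarrow> complex) \<Rightarrow> (complex^'m) set \<Rightarrow> bool" where
  "holomorphic_fun_on f U \<longleftrightarrow>
     (\<forall>z\<in>U. (f has_derivative (\<lambda>h. \<Sum>j\<in>UNIV. dZ j f z * h $ j)) (at z))"

lemma dZ_eq_coefficient:
  assumes "(f has_derivative (\<lambda>h. \<Sum>j\<in>UNIV. c j * h $ j)) (at z)"
  shows "dZ j f z = c j"
  unfolding dZ_def frechet_derivative_at[OF assms, symmetric]
  by (simp add: axis_def if_distrib sum.delta mult.commute[of "c j"] mult.assoc[symmetric]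
      cong: if_cong)

lemma holomorphic_fun_onI:
  assumes "\<And>z. z \<in> U \<Longrightarrow> \<exists>c. (f has_derivative (\<lambda>h. \<Sum>j\<in>UNIV. c j * h $ j)) (at z)"
  shows "holomorphic_fun_on f U"
  unfolding holomorphic_fun_on_def
proof
  fix z assume "z \<in> U"
  then obtain c where c: "(f has_derivative (\<lambda>h. \<Sum>j\<in>UNIV. c j * h $ j)) (at z)"
    using assms by blast
  show "(f has_derivative (\<lambda>h. \<Sum>j\<in>UNIV. dZ j f z * h $ j)) (at z)"
    using c dZ_eq_coefficient[OF c] by simp
qed

lemma holomorphic_fun_on_slice:
  assumes "holomorphic_fun_on f U" "z + axis j \<zeta> \<in> U"
  shows "((\<lambda>\<zeta>. f (z + axis j \<zeta>)) has_field_derivative dZ j f (z + axis j \<zeta>)) (at \<zeta>)"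
proof -
  have "((\<lambda>\<zeta>. z + axis j \<zeta>) has_derivative axis j) (at \<zeta>)"
    using has_derivative_add[OF has_derivative_const
        bounded_linear_imp_has_derivative[OF bounded_linear_axis]] by simp
  from has_derivative_compose[OF this
      assms(1)[unfolded holomorphic_fun_on_def, THEN bspec, OF assms(2)]]
  show ?thesis
    unfolding has_field_derivative_def
    by (simp add: axis_def if_distrib sum.delta cong: if_cong)
qed

text \<open>Cauchy's formula for the derivative at the centre of a disc in the \<open>j\<close>-th coordinate line, with
  the contour integral over the circle of radius \<open>r\<close> written as an integral over \<open>[0,1]\<close>. The integrand
  depends on \<open>z\<close> only through \<open>f\<close>, which makes it possible to differentiate in \<open>z\<close>.\<close>

lemma dZ_Cauchy_integral:
  assumes hol: "holomorphic_fun_on f U" and "r > 0"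
    and disc: "\<And>\<zeta>. norm \<zeta> \<le> r \<Longrightarrow> z + axis j \<zeta> \<in> U"
  shows "dZ j f z =
    integral (cbox 0 1) (\<lambda>t. exp (- (2 * of_real pi * \<i> * of_real t)) / of_real r *
      f (z + axis j (of_real r * exp (2 * of_real pi * \<i> * of_real t))))"
proof -
  let ?\<phi> = "\<lambda>\<zeta>. f (z + axis j \<zeta>)"
  have D: "(?\<phi> has_field_derivative dZ j f (z + axis j \<zeta>)) (at \<zeta>)" if "norm \<zeta> \<le> r" for \<zeta>
    by (rule holomorphic_fun_on_slice[OF hol disc[OF that]])
  have "continuous_on (cball 0 r) ?\<phi>"
    using D by (intro continuous_at_imp_continuous_on) (metis DERIV_isCont mem_cball_0)
  moreover have "?\<phi> holomorphic_on ball 0 r"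
    using D by (force simp: holomorphic_on_open)
  ultimately have "(?\<phi> has_field_derivative
      (1 / (2 * of_real pi * \<i>) * contour_integral (circlepath 0 r) (\<lambda>u. ?\<phi> u / (u - 0)^2))) (at 0)"
    using \<open>r > 0\<close> by (intro Cauchy_derivative_integral_circlepath) auto
  moreover have "(?\<phi> has_field_derivative dZ j f z) (at 0)"
    using D[of 0] \<open>r > 0\<close> by (simp add: axis_def zero_vec_def[symmetric])
  ultimately have "dZ j f z =
      1 / (2 * of_real pi * \<i>) * contour_integral (circlepath 0 r) (\<lambda>u. ?\<phi> u / (u - 0)^2)"
    by (rule DERIV_unique[symmetric])
  also have "contour_integral (circlepath 0 r) (\<lambda>u. ?\<phi> u / (u - 0)^2) =
      integral {0..1} (\<lambda>t. 2 * of_real pi * \<i> *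
        (exp (- (2 * of_real pi * \<i> * of_real t)) / of_real r *
         ?\<phi> (of_real r * exp (2 * of_real pi * \<i> * of_real t))))"
    unfolding contour_integral_integral vector_derivative_circlepath
  proof (intro integral_cong)
    fix t :: real
    define E where "E = exp (2 * of_real pi * \<i> * of_real t)"
    have "E \<noteq> 0" "exp (- (2 * of_real pi * \<i> * of_real t)) = inverse E"
      by (simp_all add: E_def exp_minus)
    moreover have "circlepath 0 r t = of_real r * E"
      by (simp add: circlepath E_def)
    ultimately show "?\<phi> (circlepath 0 r t) / (circlepath 0 r t - 0)^2 *
        (of_real (2 * pi) * \<i> * of_real r * exp (2 * of_real pi * \<i> * of_real t)) =
        2 * of_real pi * \<i> * (exp (- (2 * of_real pi * \<i> * of_real t)) / of_real r *
         ?\<phi> (of_real r * exp (2 * of_real pi * \<i> * of_real t)))"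
      using \<open>r > 0\<close> unfolding E_def[symmetric] by (simp add: field_simps power2_eq_square)
  qed
  finally show ?thesis by simp
qed

lemma holomorphic_fun_continuous:
  assumes "holomorphic_fun_on f U"
  shows "continuous_on U f"
  using assms unfolding holomorphic_fun_on_def
  by (intro continuous_at_imp_continuous_on ballI)
     (blast dest: has_derivative_continuous)

text \<open>One radius works for all nearby centres, so the integral formula is available with a fixed
  contour on a neighbourhood.\<close>

lemma polydisc_subset:
  fixes z0 :: "complex^'m"
  assumes "open U" "z0 \<in> U"
  obtains r where "r > 0" "ball z0 r \<subseteq> U"
    "\<And>z \<zeta> j. z \<in> ball z0 r \<Longrightarrow> norm \<zeta> \<le> r \<Longrightarrow> z + axis j \<zeta> \<in> U"
proof -
  obtain e where e: "e > 0" "ball z0 e \<subseteq> U" using assms openE by blast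
  have na: "norm (axis j \<zeta> :: complex^'m) = norm \<zeta>" for j \<zeta>
    by (simp add: norm_eq_sqrt_inner inner_axis_axis)
  show ?thesis
  proof (rule that[of "e / 2"])
    show "z + axis j \<zeta> \<in> U" if "z \<in> ball z0 (e / 2)" "norm \<zeta> \<le> e / 2" for z \<zeta> j
    proof -
      have "norm ((z - z0) + axis j \<zeta>) \<le> norm (z - z0) + norm (axis j \<zeta> :: complex^'m)"
        by (rule norm_triangle_ineq)
      also have "\<dots> < e" using that na[of j \<zeta>] by (simp add: dist_norm norm_minus_commute)
      finally have "z + axis j \<zeta> \<in> ball z0 e"
        by (simp add: dist_norm norm_minus_commute[of z0] algebra_simps)
      then show ?thesis using e by blast
    qed
  qed (use e in auto)
qed

lemma continuous_on_dZ:
  fixes f :: "complex^'m \<Rightarrow> complex"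
  assumes "open U" "holomorphic_fun_on f U"
  shows "continuous_on U (dZ j f)"
proof (rule continuous_at_imp_continuous_on, rule ballI)
  fix z0 assume "z0 \<in> U"
  then obtain r where r: "r > 0" "ball z0 r \<subseteq> U"
      and disc: "\<And>z \<zeta> j. z \<in> ball z0 r \<Longrightarrow> norm \<zeta> \<le> r \<Longrightarrow> z + axis j \<zeta> \<in> U"
    using polydisc_subset[OF assms(1)] by blast
  let ?k = "\<lambda>t. exp (- (2 * of_real pi * \<i> * of_real t)) / of_real r"
  let ?p = "\<lambda>t. of_real r * exp (2 * of_real pi * \<i> * of_real t)"
  have np: "norm (?p t) \<le> r" for t using r(1) by (simp add: norm_mult)
  have "continuous_on (ball z0 r) (\<lambda>z. integral (cbox 0 1) (\<lambda>t. ?k t * f (z + axis j (?p t))))"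
  proof (rule integral_continuous_on_param, unfold split_beta)
    have "continuous_on (ball z0 r \<times> cbox 0 1) (\<lambda>x. f (fst x + axis j (?p (snd x))))"
      using disc np
      by (intro continuous_on_compose2[OF holomorphic_fun_continuous[OF assms(2)]]
          continuous_intros bounded_linear.continuous_on[OF bounded_linear_axis]) auto
    then show "continuous_on (ball z0 r \<times> cbox 0 1)
        (\<lambda>x. ?k (snd x) * f (fst x + axis j (?p (snd x))))"
      using r(1) by (intro continuous_intros) auto
  qed
  moreover have "dZ j f z = integral (cbox 0 1) (\<lambda>t. ?k t * f (z + axis j (?p t)))"
    if "z \<in> ball z0 r" for z
    by (rule dZ_Cauchy_integral[OF assms(2) r(1) disc[OF that]])
  then have "continuous_on (ball z0 r) (dZ j f) \<longleftrightarrow> continuous_on (ball z0 r)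
      (\<lambda>z. integral (cbox 0 1) (\<lambda>t. ?k t * f (z + axis j (?p t))))"
    by (rule continuous_on_cong[OF refl])
  ultimately have "continuous_on (ball z0 r) (dZ j f)" by (simp only:)
  then show "isCont (dZ j f) z0"
    using r(1) by (simp add: continuous_on_eq_continuous_at)
qed

text \<open>Differentiation under the integral sign in Cauchy's formula. The derivative of the integrand is
  continuous by \<open>continuous_on_dZ\<close>, and complex linearity survives the integration.\<close>

lemma holomorphic_fun_on_dZ:
  fixes f :: "complex^'m \<Rightarrow> complex"
  assumes "open U" "holomorphic_fun_on f U"
  shows "holomorphic_fun_on (dZ j f) U"
proof (rule holomorphic_fun_onI)
  fix z0 assume "z0 \<in> U"
  then obtain r where r: "r > 0" "ball z0 r \<subseteq> U"
      and disc: "\<And>z \<zeta> j. z \<in> ball z0 r \<Longrightarrow> norm \<zeta> \<le> r \<Longrightarrow> z + axis j \<zeta> \<in> U"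
    using polydisc_subset[OF assms(1)] by blast
  define k where "k t = exp (- (2 * of_real pi * \<i> * of_real t)) / of_real r" for t :: real
  define p where "p t = of_real r * exp (2 * of_real pi * \<i> * of_real t)" for t :: real
  have np: "norm (p t) \<le> r" for t using r(1) by (simp add: norm_mult p_def)
  have ck: "continuous_on S (\<lambda>x. k (g x))" if "continuous_on S g" for g :: "'x::topological_space \<Rightarrow> real" and S
    unfolding k_def using r(1) that by (intro continuous_intros) auto
  have cp: "continuous_on S (\<lambda>x. axis j (p (g x)) :: complex^'m)"
    if "continuous_on S g" for g :: "'x::topological_space \<Rightarrow> real" and S
    unfolding p_def using that
    by (intro bounded_linear.continuous_on[OF bounded_linear_axis] continuous_intros)
  define proj where "proj i = Blinfun (\<lambda>h :: complex^'m. h $ i)" for i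
  have proj: "blinfun_apply (proj i) h = h $ i" for i h
    unfolding proj_def by (simp add: bounded_linear_Blinfun_apply bounded_linear_vec_nth)
  define c where "c i z t = k t * dZ i f (z + axis j (p t))" for i z t
  define D where "D z t = (\<Sum>i\<in>UNIV. blinfun_mult_right (c i z t) o\<^sub>L proj i)" for z t
  have cont_c: "continuous_on (ball z0 r \<times> cbox 0 1) (\<lambda>x. c i (fst x) (snd x))" for i
    unfolding c_def using disc np
    by (intro continuous_on_mult ck continuous_on_snd continuous_on_id
        continuous_on_compose2[OF continuous_on_dZ[OF assms]] continuous_on_add continuous_on_fst cp) auto
  have cont_D: "continuous_on (ball z0 r \<times> cbox 0 1) (\<lambda>x. D (fst x) (snd x))"
    unfolding D_def
    by (intro continuous_intros bounded_linear.continuous_on[OF bounded_linear_blinfun_mult_right] cont_c)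
  have cont_slice: "continuous_on (cbox 0 1) (\<lambda>t. g z t)"
    if "continuous_on (ball z0 r \<times> cbox 0 1) (\<lambda>x. g (fst x) (snd x))" "z \<in> ball z0 r"
    for g :: "complex^'m \<Rightarrow> real \<Rightarrow> 'b::real_normed_vector" and z
  proof -
    have "continuous_on (cbox 0 1) (\<lambda>t :: real. (z, t))"
      by (intro continuous_intros)
    moreover have "(\<lambda>t :: real. (z, t)) ` cbox 0 1 \<subseteq> ball z0 r \<times> cbox 0 1"
      using that(2) by auto
    ultimately show ?thesis
      using continuous_on_compose2[OF that(1), of "cbox 0 1" "\<lambda>t. (z, t)"]
      by (simp only: fst_conv snd_conv)
  qed
  have z0: "z0 \<in> ball z0 r" using r(1) by simp
  have "((\<lambda>z. integral (cbox 0 1) (\<lambda>t. k t * f (z + axis j (p t)))) has_derivative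
      blinfun_apply (integral (cbox 0 1) (D z0))) (at z0 within ball z0 r)"
  proof (rule leibniz_rule[OF _ _ _ z0 convex_ball])
    fix z t assume z: "z \<in> ball z0 r"
    have "(f has_derivative (\<lambda>h. \<Sum>i\<in>UNIV. dZ i f (z + axis j (p t)) * h $ i)) (at (z + axis j (p t)))"
      using assms(2) disc[OF z np] unfolding holomorphic_fun_on_def by blast
    moreover have "((\<lambda>z. z + axis j (p t)) has_derivative (\<lambda>h. h)) (at z within ball z0 r)"
      using has_derivative_add[OF has_derivative_ident has_derivative_const] by simp
    ultimately have "((\<lambda>z. f (z + axis j (p t))) has_derivative
        (\<lambda>h. \<Sum>i\<in>UNIV. dZ i f (z + axis j (p t)) * h $ i)) (at z within ball z0 r)"
      using has_derivative_compose[where f = "\<lambda>z. z + axis j (p t)" and g = f] by blast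
    from has_derivative_mult_right[OF this, of "k t"]
    show "((\<lambda>z. k t * f (z + axis j (p t))) has_derivative blinfun_apply (D z t))
        (at z within ball z0 r)"
      by (rule has_derivative_eq_rhs)
        (simp add: fun_eq_iff D_def c_def proj blinfun.sum_left sum_distrib_left mult.assoc)
  next
    fix z assume z: "z \<in> ball z0 r"
    show "(\<lambda>t. k t * f (z + axis j (p t))) integrable_on cbox 0 1"
      using disc[OF z np]
      by (intro integrable_continuous continuous_on_mult ck continuous_on_id
          continuous_on_compose2[OF holomorphic_fun_continuous[OF assms(2)]]
          continuous_on_add continuous_on_const cp) auto
  next
    show "continuous_on (ball z0 r \<times> cbox 0 1) (\<lambda>(z, t). D z t)"
      using cont_D by (simp add: split_beta)
  qed
  then have "(dZ j f has_derivative blinfun_apply (integral (cbox 0 1) (D z0)))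
      (at z0 within ball z0 r)"
  proof (rule has_derivative_transform[OF z0, rotated])
    show "dZ j f z = integral (cbox 0 1) (\<lambda>t. k t * f (z + axis j (p t)))"
      if "z \<in> ball z0 r" for z
      unfolding k_def p_def by (rule dZ_Cauchy_integral[OF assms(2) r(1) disc[OF that]])
  qed
  then have "(dZ j f has_derivative blinfun_apply (integral (cbox 0 1) (D z0))) (at z0)"
    using at_within_open[OF z0 open_ball] by simp
  moreover have "blinfun_apply (integral (cbox 0 1) (D z0)) h
      = (\<Sum>i\<in>UNIV. integral (cbox 0 1) (c i z0) * h $ i)" for h
  proof -
    have "blinfun_apply (integral (cbox 0 1) (D z0)) h
        = integral (cbox 0 1) (\<lambda>t. blinfun_apply (D z0 t) h)"
      using cont_slice[OF cont_D z0]
      by (intro blinfun_apply_integral integrable_continuous)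
    also have "\<dots> = integral (cbox 0 1) (\<lambda>t. \<Sum>i\<in>UNIV. c i z0 t * h $ i)"
      by (simp add: D_def proj blinfun.sum_left)
    also have "\<dots> = (\<Sum>i\<in>UNIV. integral (cbox 0 1) (\<lambda>t. c i z0 t * h $ i))"
      by (intro integral_sum integrable_continuous continuous_on_mult continuous_on_const
          cont_slice[OF cont_c z0]) auto
    finally show ?thesis by simp
  qed
  then have "blinfun_apply (integral (cbox 0 1) (D z0))
      = (\<lambda>h. \<Sum>i\<in>UNIV. integral (cbox 0 1) (c i z0) * h $ i)" by (rule ext)
  ultimately show "\<exists>c. (dZ j f has_derivative (\<lambda>h. \<Sum>i\<in>UNIV. c i * h $ i)) (at z0)"
    by (intro exI[of _ "\<lambda>i. integral (cbox 0 1) (c i z0)"]) (simp only:)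
qed

lemma holomorphic_fun_imp_Ck:
  fixes f :: "complex^'m \<Rightarrow> complex"
  assumes "open U" "holomorphic_fun_on f U"
  shows "Ck_on k f U"
  using assms(2)
proof (induction k arbitrary: f)
  case 0
  then show ?case by (simp add: holomorphic_fun_continuous)
next
  case (Suc k)
  show ?case
  proof (rule Ck_on_SucI[OF assms(1)])
    show "(f has_derivative (\<lambda>h. \<Sum>j\<in>UNIV. dZ j f z * h $ j)) (at z)" if "z \<in> U" for z
      using Suc.prems that by (auto simp: holomorphic_fun_on_def)
    have "Ck_on k (dZ j f) U" for j
      by (rule Suc.IH[OF holomorphic_fun_on_dZ[OF assms(1) Suc.prems]])
    then show "Ck_on k (\<lambda>z. \<Sum>j\<in>UNIV. dZ j f z * v $ j) U" for v
      by (intro Ck_on_sum[OF assms(1)] Ck_on_mult[OF assms(1)] Ck_on_const)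
  qed
qed

lemma holomorphic_map_component:
  assumes "holomorphic_map_on F U"
  shows "holomorphic_fun_on (\<lambda>z. F z $ i) U"
proof (rule holomorphic_fun_onI)
  fix z assume "z \<in> U"
  then obtain A where "(F has_derivative (\<lambda>h. A *v h)) (at z)"
    using assms unfolding holomorphic_map_on_def by blast
  from bounded_linear.has_derivative[OF bounded_linear_vec_nth this, of i]
  show "\<exists>c. ((\<lambda>z. F z $ i) has_derivative (\<lambda>h. \<Sum>j\<in>UNIV. c j * h $ j)) (at z)"
    by (intro exI[of _ "\<lambda>j. A $ i $ j"]) (simp add: matrix_vector_mult_def)
qed

lemma holomorphic_map_has_derivative:
  assumes "holomorphic_map_on F U" "z \<in> U"
  shows "(F has_derivative (\<lambda>h. jacobian_Z F z *v h)) (at z)"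
proof -
  obtain A where A: "(F has_derivative (\<lambda>h. A *v h)) (at z)"
    using assms unfolding holomorphic_map_on_def by blast
  have "((\<lambda>z. F z $ i) has_derivative (\<lambda>h. \<Sum>j\<in>UNIV. A $ i $ j * h $ j)) (at z)" for i
    using bounded_linear.has_derivative[OF bounded_linear_vec_nth A, of i]
    by (simp add: matrix_vector_mult_def)
  from dZ_eq_coefficient[OF this] have "jacobian_Z F z = A"
    by (simp add: jacobian_Z_def vec_eq_iff)
  then show ?thesis using A by simp
qed

section \<open>Complex gradients and tangent directions\<close>

text \<open>What the proof uses of a local defining function, with real analyticity weakened to smoothness
  and the neighbourhood \<open>V\<close> made explicit, so that two defining functions can be compared on a common
  neighbourhood.\<close>

definition smooth_defining ::
    "(complex^'n) set \<Rightarrow> nat \<Rightarrow> (complex^'n) set \<Rightarrow> (nat \<Rightarrow> complex^'n \<Rightarrow> real) \<Rightarrow> bool" where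
  "smooth_defining M d V \<rho> \<longleftrightarrow>
     open V \<and> M \<inter> V = {Z \<in> V. \<forall>j<d. \<rho> j Z = 0} \<and> (\<forall>j<d. smooth_on (\<rho> j) V) \<and>
     (\<forall>Z\<in>V. \<forall>c :: nat \<Rightarrow> complex.
        (\<Sum>j<d. c j *s complex_gradient (\<rho> j) Z) = 0 \<longrightarrow> (\<forall>j<d. c j = 0))"

lemma local_defining_imp_smooth:
  assumes "local_defining_function M d p \<rho>"
  shows "\<exists>V. p \<in> V \<and> smooth_defining M d V \<rho>"
proof -
  from assms obtain U where "open U" "p \<in> U" "M \<inter> U = {Z \<in> U. \<forall>j<d. \<rho> j Z = 0}"
      "\<forall>j<d. real_analytic_on (\<rho> j) U"
      "\<forall>Z\<in>U. \<forall>c. (\<Sum>j<d. c j *s complex_gradient (\<rho> j) Z) = 0 \<longrightarrow> (\<forall>j<d. c j = 0)"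
    unfolding local_defining_function_def by (elim exE conjE)
  then show ?thesis
    unfolding smooth_defining_def
    by (intro exI[of _ U] conjI allI impI real_analytic_imp_smooth) simp_all
qed

text \<open>Complex bilinear, without conjugation: the differential of a real function \<open>r\<close> is
  \<open>v \<mapsto> 2 Re (pairing r\<^sub>Z v)\<close>.\<close>

abbreviation pairing :: "complex^'n \<Rightarrow> complex^'n \<Rightarrow> complex" where
  "pairing g v \<equiv> (\<Sum>i\<in>UNIV. g $ i * v $ i)"

lemma real_linear_axis_expansion:
  fixes D :: "complex^'n \<Rightarrow> 'b::real_vector"
  assumes "linear D"
  shows "D v = (\<Sum>i\<in>UNIV. Re (v $ i) *\<^sub>R D (axis i 1) + Im (v $ i) *\<^sub>R D (axis i \<i>))"
proof -
  have "v = (\<Sum>i\<in>UNIV. Re (v $ i) *\<^sub>R axis i 1 + Im (v $ i) *\<^sub>R axis i \<i>)"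
    unfolding vec_eq_iff sum_component
  proof
    fix k
    have "(Re (v $ i) *\<^sub>R axis i 1 + Im (v $ i) *\<^sub>R axis i \<i>) $ k = (if i = k then v $ k else 0)" for i
      by (simp add: axis_def complex_eq_iff)
    then show "v $ k = (\<Sum>i\<in>UNIV. (Re (v $ i) *\<^sub>R axis i 1 + Im (v $ i) *\<^sub>R axis i \<i>) $ k)"
      by simp
  qed
  then have "D v = D (\<Sum>i\<in>UNIV. Re (v $ i) *\<^sub>R axis i 1 + Im (v $ i) *\<^sub>R axis i \<i>)" by simp
  also have "\<dots> = (\<Sum>i\<in>UNIV. Re (v $ i) *\<^sub>R D (axis i 1) + Im (v $ i) *\<^sub>R D (axis i \<i>))"
    using assms by (simp add: linear_sum linear_add linear_cmul)
  finally show ?thesis .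
qed

lemma frechet_derivative_of_real:
  assumes "(\<rho> has_derivative D) (at p)"
  shows "frechet_derivative (\<lambda>Z. complex_of_real (\<rho> Z)) (at p) = (\<lambda>v. complex_of_real (D v))"
  using has_derivative_of_real[OF assms] by (rule frechet_derivative_at[symmetric])

lemma complex_gradient_nth:
  assumes "(\<rho> has_derivative D) (at p)"
  shows "complex_gradient \<rho> p $ i = (complex_of_real (D (axis i 1)) - \<i> * complex_of_real (D (axis i \<i>))) / 2"
  by (simp add: complex_gradient_def dZ_def frechet_derivative_of_real[OF assms])

lemma derivative_eq_pairing_gradient:
  assumes "(\<rho> has_derivative D) (at p)"
  shows "D v = 2 * Re (pairing (complex_gradient \<rho> p) v)"
proof -
  have "D v = (\<Sum>i\<in>UNIV. Re (v $ i) * D (axis i 1) + Im (v $ i) * D (axis i \<i>))"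
    using real_linear_axis_expansion[OF has_derivative_linear[OF assms], of v] by simp
  also have "\<dots> = (\<Sum>i\<in>UNIV. 2 * Re (complex_gradient \<rho> p $ i * v $ i))"
    by (intro sum.cong refl) (simp add: complex_gradient_nth[OF assms] field_simps)
  finally show ?thesis by (simp add: sum_distrib_left)
qed

lemma complex_gradient_eqI:
  assumes "(\<rho> has_derivative (\<lambda>v. 2 * Re (pairing g v))) (at p)"
  shows "complex_gradient \<rho> p = g"
proof -
  have "pairing g (axis i c) = g $ i * c" for i c
    by (simp add: axis_def if_distrib sum.delta cong: if_cong)
  then show ?thesis
    by (simp add: vec_eq_iff complex_gradient_nth[OF assms] complex_eq_iff)
qed

lemma Ck_on_complex_gradient:
  assumes "open V" "Ck_on (Suc k) \<rho> V"
  shows "Ck_on k (\<lambda>q. complex_gradient \<rho> q $ i) V"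
proof (rule Ck_on_cong[OF assms(1)])
  let ?D = "\<lambda>v q. frechet_derivative \<rho> (at q) v"
  show "(1/2) * complex_of_real (?D (axis i 1) q) + (- \<i> / 2) * complex_of_real (?D (axis i \<i>) q)
      = complex_gradient \<rho> q $ i" if "q \<in> V" for q
    using complex_gradient_nth[OF Ck_on_Suc_has_derivative[OF assms(2) that]]
    by (simp add: field_simps)
  have D: "Ck_on k (\<lambda>q. complex_of_real (?D v q)) V" for v
    using assms(2) by (intro Ck_on_bounded_linear[OF assms(1) bounded_linear_of_real]) simp
  show "Ck_on k (\<lambda>q. (1/2) * complex_of_real (?D (axis i 1) q)
      + (- \<i> / 2) * complex_of_real (?D (axis i \<i>) q)) V"
    by (intro Ck_on_add[OF assms(1)] Ck_on_mult[OF assms(1)] Ck_on_const D)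
qed

lemma dual_vectors:
  fixes g :: "nat \<Rightarrow> complex^'n"
  assumes indep: "\<And>c :: nat \<Rightarrow> complex. (\<Sum>j<d. c j *s g j) = 0 \<Longrightarrow> \<forall>j<d. c j = 0"
  shows "\<exists>x. \<forall>i<d. \<forall>j<d. pairing (g i) (x j) = (if i = j then 1 else 0)"
proof -
  have inj: "inj_on g {..<d}"
  proof (rule inj_onI, rule ccontr)
    fix i j assume ij: "i \<in> {..<d}" "j \<in> {..<d}" "g i = g j" "i \<noteq> j"
    let ?c = "\<lambda>k. (if k = i then 1 else 0) + (if k = j then - 1 else 0 :: complex)"
    have c1: "(\<Sum>k<d. (if k = l then s else 0) *s g k) = s *s g l" if "l < d" for l and s :: complex
      using that sum.delta[of "{..<d}" l "\<lambda>k. s *s g k"]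
      by (simp add: if_distrib[of "\<lambda>s. s *s _"] cong: if_cong)
    have "(\<Sum>k<d. ?c k *s g k) = (\<Sum>k<d. (if k = i then 1 else 0) *s g k)
        + (\<Sum>k<d. (if k = j then - 1 else 0) *s g k)"
      by (simp only: vec.scale_left_distrib sum.distrib)
    also have "\<dots> = 0" using ij by (simp only: c1 lessThan_iff) (simp add: vec.scale_minus_left)
    finally have "?c i = 0" using indep[of ?c] ij by auto
    then show False using ij by simp
  qed
  have ind: "vec.independent (g ` {..<d})"
  proof (rule vec.independent_if_scalars_zero)
    fix c x assume "(\<Sum>x\<in>g ` {..<d}. c x *s x) = 0" "x \<in> g ` {..<d}"
    then show "c x = 0"
      using indep[of "\<lambda>j. c (g j)"] by (auto simp: sum.reindex[OF inj])
  qed simp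
  \<comment> \<open>A complex linear map with values \<open>axis k0 1\<close> or \<open>0\<close>, read off in the coordinate \<open>k0\<close>, is a linear functional.\<close>
  fix k0 :: 'n
  have "\<exists>x. \<forall>i<d. pairing (g i) x = (if i = j then 1 else 0)" if "j < d" for j
  proof -
    obtain f where f: "Vector_Spaces.linear (*s) (*s) f"
        "\<forall>v\<in>g ` {..<d}. f v = (if v = g j then axis k0 1 else 0 :: complex^'n)"
      using vec.linear_independent_extend[OF ind, of "\<lambda>v. if v = g j then axis k0 1 else 0"] by blast
    have "pairing (g i) (\<chi> k. f (axis k 1) $ k0) = (if i = j then 1 else 0)" if "i < d" for i
    proof -
      have "f (g i) = matrix f *v g i" using matrix_works[OF f(1)] by simp
      then have "f (g i) $ k0 = pairing (g i) (\<chi> k. f (axis k 1) $ k0)"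
        by (simp add: matrix_def matrix_vector_mult_def mult.commute)
      moreover have "g i = g j \<longleftrightarrow> i = j" using inj that \<open>j < d\<close> by (auto dest: inj_onD)
      ultimately show ?thesis using f(2) that by (auto simp: axis_def)
    qed
    then show ?thesis by blast
  qed
  then have "\<forall>j\<in>{..<d}. \<exists>x. \<forall>i<d. pairing (g i) x = (if i = j then 1 else 0)" by simp
  then obtain x where "\<forall>j\<in>{..<d}. \<forall>i<d. pairing (g i) (x j) = (if i = j then 1 else 0)"
    by (rule bchoice[THEN exE])
  then show ?thesis by (intro exI[of _ x]) simp
qed

text \<open>A vector \<open>v\<close> killed by the differentials of the defining functions is a limit of secants of \<open>M\<close> at
  \<open>p\<close>. With \<open>w\<close> dual to these differentials, the map \<open>\<Phi>\<close> below has the identity as derivative at \<open>p\<close>, and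
  it transforms the equations \<open>\<rho> j = 0\<close> into the linear equations \<open>D j = 0\<close>, which \<open>t *\<^sub>R v\<close> satisfies.
  Brouwer's theorem provides a solution of \<open>\<Phi> y = t *\<^sub>R v\<close> close to \<open>p + t *\<^sub>R v\<close>, and \<open>y\<close> lies on \<open>M\<close>.\<close>

lemma tangent_direction_secants:
  fixes M :: "(complex^'n) set"
  assumes sd: "smooth_defining M d V \<rho>" and p: "p \<in> M" "p \<in> V"
    and tangent: "\<And>j. j < d \<Longrightarrow> Re (pairing (complex_gradient (\<rho> j) p) v) = 0"
    and "e > 0"
  shows "\<exists>\<delta>>0. \<forall>t. 0 < t \<and> t < \<delta> \<longrightarrow> (\<exists>x\<in>M. norm (x - p - t *\<^sub>R v) \<le> e * t)"
proof -
  have V: "open V" and MV: "M \<inter> V = {Z \<in> V. \<forall>j<d. \<rho> j Z = 0}"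
    and Ck: "\<And>j k. j < d \<Longrightarrow> Ck_on k (\<rho> j) V"
    using sd by (auto simp: smooth_defining_def smooth_on_def)
  define D where "D j = frechet_derivative (\<rho> j) (at p)" for j
  have D: "(\<rho> j has_derivative D j) (at p)" if "j < d" for j
    unfolding D_def using Ck_on_Suc_has_derivative[OF Ck[OF that, of "Suc 0"] p(2)] .
  have lin: "linear (D j)" if "j < d" for j using D[OF that] by (rule has_derivative_linear)
  obtain x where x: "\<forall>i<d. \<forall>j<d. pairing (complex_gradient (\<rho> i) p) (x j) = (if i = j then 1 else 0)"
    using dual_vectors[where d = d and g = "\<lambda>j. complex_gradient (\<rho> j) p"] sd p(2)
    unfolding smooth_defining_def by blast
  \<comment> \<open>The factor \<open>1/2\<close> compensates the \<open>2\<close> in \<open>D j v = 2 Re (pairing (\<rho> j)\<^sub>Z v)\<close>.\<close>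
  define w where "w j = (1/2) *\<^sub>R x j" for j
  have Dw: "D i (w j) = (if i = j then 1 else 0)" if "i < d" "j < d" for i j
  proof -
    have "D i (w j) = (1/2) * D i (x j)" using lin[OF that(1)] by (simp add: w_def linear_cmul)
    also have "D i (x j) = 2 * Re (if i = j then 1 else 0)"
      using derivative_eq_pairing_gradient[OF D[OF that(1)], of "x j"] x that by simp
    finally show ?thesis by simp
  qed
  have Dv: "D j v = 0" if "j < d" for j
    using derivative_eq_pairing_gradient[OF D[OF that]] tangent[OF that] by simp
  define \<Phi> where "\<Phi> y = (y - p) + (\<Sum>j<d. (\<rho> j y - D j (y - p)) *\<^sub>R w j)" for y
  have D\<Phi>: "D i (\<Phi> y) = \<rho> i y" if "i < d" for i y
  proof -
    have "D i (\<Phi> y) = D i (y - p) + (\<Sum>j<d. (\<rho> j y - D j (y - p)) * D i (w j))"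
      unfolding \<Phi>_def using lin[OF that] by (simp add: linear_add linear_sum linear_cmul)
    also have "(\<Sum>j<d. (\<rho> j y - D j (y - p)) * D i (w j))
        = (\<Sum>j<d. if j = i then \<rho> j y - D j (y - p) else 0)"
      using Dw[OF that] by (intro sum.cong) auto
    also have "\<dots> = \<rho> i y - D i (y - p)" using that by simp
    finally show ?thesis by simp
  qed
  have \<Phi>': "(\<Phi> has_derivative (\<lambda>h. h)) (at p)"
  proof -
    have "((\<lambda>y. \<rho> j y - D j (y - p)) has_derivative (\<lambda>h. 0)) (at p)" if "j < d" for j
    proof -
      have "bounded_linear (D j)" using D[OF that] by (rule has_derivative_bounded_linear)
      from bounded_linear.has_derivative[OF this, of "\<lambda>y. y - p" "\<lambda>h. h" "at p"]
      have "((\<lambda>y. D j (y - p)) has_derivative D j) (at p)"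
        using has_derivative_diff[OF has_derivative_ident has_derivative_const, of p] by simp
      from has_derivative_diff[OF D[OF that] this] show ?thesis by simp
    qed
    then have "((\<lambda>y. \<Sum>j<d. (\<rho> j y - D j (y - p)) *\<^sub>R w j) has_derivative (\<lambda>h. \<Sum>j<d. 0 *\<^sub>R w j)) (at p)"
      by (intro has_derivative_sum has_derivative_scaleR_left) simp
    from has_derivative_add[OF has_derivative_diff[OF has_derivative_ident has_derivative_const, of p] this]
    show ?thesis unfolding \<Phi>_def by simp
  qed
  have "\<Phi> p = 0"
  proof -
    have "\<rho> j p - D j (p - p) = 0" if "j < d" for j
      using that MV p linear_0[OF lin[OF that]] by auto
    then show ?thesis by (simp add: \<Phi>_def)
  qed
  \<comment> \<open>With this \<open>\<epsilon>\<close> the map \<open>y \<mapsto> t *\<^sub>R v + (y - \<Phi> y)\<close> sends the ball \<open>?B\<close> below into itself.\<close>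
  define \<epsilon> where "\<epsilon> = e / (norm v + e)"
  have den: "norm v + e > 0" using \<open>e > 0\<close> by (smt (verit) norm_ge_zero)
  then have "\<epsilon> > 0" using \<open>e > 0\<close> by (simp add: \<epsilon>_def)
  then obtain \<delta>1 where \<delta>1: "\<delta>1 > 0"
      "\<And>y. norm (y - p) < \<delta>1 \<Longrightarrow> norm (\<Phi> y - (y - p)) \<le> \<epsilon> * norm (y - p)"
    using \<Phi>' \<open>\<Phi> p = 0\<close> unfolding has_derivative_at_alt by (metis diff_zero)
  obtain \<delta>2 where \<delta>2: "\<delta>2 > 0" "ball p \<delta>2 \<subseteq> V" using V p(2) openE by blast
  define \<delta> where "\<delta> = min \<delta>1 \<delta>2 / (norm v + e)"
  have "\<delta> > 0" using \<delta>1 \<delta>2 den by (simp add: \<delta>_def)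
  moreover have "\<exists>x\<in>M. norm (x - p - t *\<^sub>R v) \<le> e * t" if t: "0 < t" "t < \<delta>" for t
  proof -
    let ?B = "cball (p + t *\<^sub>R v) (e * t)"
    have near: "norm (y - p) \<le> t * (norm v + e)" if "y \<in> ?B" for y
    proof -
      have "norm (y - p) \<le> norm (y - (p + t *\<^sub>R v)) + norm (t *\<^sub>R v)"
        using norm_triangle_ineq[of "y - (p + t *\<^sub>R v)" "t *\<^sub>R v"] by (simp add: algebra_simps)
      also have "\<dots> \<le> e * t + t * norm v" using that t by (simp add: dist_norm norm_minus_commute)
      finally show ?thesis by (simp add: algebra_simps)
    qed
    have "t * (norm v + e) < min \<delta>1 \<delta>2" using t(2) den by (simp add: \<delta>_def pos_less_divide_eq)
    then have small: "norm (y - p) < \<delta>1" "norm (y - p) < \<delta>2" if "y \<in> ?B" for y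
      using near[OF that] by linarith+
    have BV: "?B \<subseteq> V"
      using small(2) \<delta>2(2) by (auto simp: subset_iff dist_norm norm_minus_commute)
    have cont: "continuous_on ?B \<Phi>"
    proof -
      have "continuous_on ?B (\<rho> j)" if "j < d" for j
        using Ck_on_continuous[OF Ck[OF that]] BV by (rule continuous_on_subset)
      moreover have "continuous_on ?B (\<lambda>y. D j (y - p))" if "j < d" for j
        by (intro bounded_linear.continuous_on[OF has_derivative_bounded_linear[OF D[OF that]]]
            continuous_intros)
      ultimately show ?thesis unfolding \<Phi>_def by (intro continuous_intros) auto
    qed
    have "\<exists>y\<in>?B. \<Phi> y = t *\<^sub>R v"
    proof (rule brouwer_surjective_cball[OF cont, of "t *\<^sub>R v" "{t *\<^sub>R v}"])
      fix x y assume xy: "x \<in> {t *\<^sub>R v}" "y \<in> ?B"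
      have "norm (\<Phi> y - (y - p)) \<le> \<epsilon> * norm (y - p)" using \<delta>1(2) small(1)[OF xy(2)] by blast
      also have "\<dots> \<le> \<epsilon> * (t * (norm v + e))" using near[OF xy(2)] \<open>\<epsilon> > 0\<close> by simp
      also have "\<dots> = e * t" using den by (simp add: \<epsilon>_def)
      finally show "x + (y - \<Phi> y) \<in> ?B"
        using xy(1) by (simp add: dist_norm algebra_simps)
    qed (use \<open>e > 0\<close> t in auto)
    then obtain y where y: "y \<in> ?B" "\<Phi> y = t *\<^sub>R v" by blast
    have "\<rho> j y = 0" if "j < d" for j
      using D\<Phi>[OF that, of y] Dv[OF that] y(2) lin[OF that] by (simp add: linear_cmul)
    then have "y \<in> M" using MV BV y(1) by blast
    moreover have "norm (y - p - t *\<^sub>R v) \<le> e * t"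
      using y(1) by (simp add: dist_norm norm_minus_commute algebra_simps)
    ultimately show ?thesis by blast
  qed
  ultimately show ?thesis by blast
qed

text \<open>The difference of two derivatives within \<open>M\<close> is a linear map that is \<open>o(|y|)\<close> on the secants
  \<open>y\<close> of \<open>M\<close> at \<open>p\<close>, so it vanishes on limits of secant directions.\<close>

lemma derivative_within_unique_on_tangent:
  fixes M :: "(complex^'n) set" and f :: "complex^'n \<Rightarrow> 'b::real_normed_vector"
  assumes sd: "smooth_defining M d V \<rho>" and p: "p \<in> M" "p \<in> V"
    and tangent: "\<And>j. j < d \<Longrightarrow> Re (pairing (complex_gradient (\<rho> j) p) v) = 0"
    and D1: "(f has_derivative D1) (at p within M)"
    and D2: "(f has_derivative D2) (at p within M)"
  shows "D1 v = D2 v"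
proof -
  define D where "D h = D1 h - D2 h" for h
  have D0: "((\<lambda>x. 0 :: 'b) has_derivative D) (at p within M)"
    using has_derivative_diff[OF D1 D2] by (simp add: D_def[abs_def])
  have bl: "bounded_linear D" using D0 by (rule has_derivative_bounded_linear)
  then obtain K where K: "K > 0" "\<And>h. norm (D h) \<le> norm h * K"
    using bounded_linear.pos_bounded by blast
  have bound: "norm (D v) \<le> e * (norm v + 1 + K)" if e: "0 < e" "e \<le> 1" for e
  proof -
    obtain \<delta>1 where \<delta>1: "\<delta>1 > 0" "\<And>y. y \<in> M \<Longrightarrow> norm (y - p) < \<delta>1 \<Longrightarrow> norm (D (y - p)) \<le> e * norm (y - p)"
      using D0 e(1) unfolding has_derivative_within_alt by (metis diff_self diff_0 norm_minus_cancel)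
    obtain \<delta>2 where \<delta>2: "\<delta>2 > 0" "\<And>t. 0 < t \<Longrightarrow> t < \<delta>2 \<Longrightarrow> \<exists>x\<in>M. norm (x - p - t *\<^sub>R v) \<le> e * t"
      using tangent_direction_secants[OF sd p tangent e(1)] by blast
    have den: "norm v + 1 > 0" by (smt (verit) norm_ge_zero)
    define t where "t = min (\<delta>1 / (norm v + 1)) \<delta>2 / 2"
    have t: "0 < t" "t < \<delta>1 / (norm v + 1)" "t < \<delta>2"
    proof -
      have half: "0 < min A \<delta>2 / 2" "min A \<delta>2 / 2 < A" "min A \<delta>2 / 2 < \<delta>2" if "A > 0" for A :: real
        using that \<delta>2(1) by (auto simp: min_def)
      have "\<delta>1 / (norm v + 1) > 0" using \<delta>1(1) den by simp
      from half[OF this] show "0 < t" "t < \<delta>1 / (norm v + 1)" "t < \<delta>2"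
        unfolding t_def by blast+
    qed
    obtain x where x: "x \<in> M" "norm (x - p - t *\<^sub>R v) \<le> e * t" using \<delta>2(2)[OF t(1,3)] by blast
    have xp: "norm (x - p) \<le> t * (norm v + 1)"
    proof -
      have "norm (x - p) \<le> norm (x - p - t *\<^sub>R v) + norm (t *\<^sub>R v)"
        using norm_triangle_ineq[of "x - p - t *\<^sub>R v" "t *\<^sub>R v"] by simp
      also have "\<dots> \<le> 1 * t + t * norm v" 
      proof (rule add_mono)
        show "norm (x - p - t *\<^sub>R v) \<le> 1 * t"
          using x(2) mult_right_mono[OF e(2), of t] t(1) by linarith
      qed (use t(1) in simp)
      finally show ?thesis by (simp add: algebra_simps)
    qed
    also have "\<dots> < \<delta>1" using t(2) den by (simp add: pos_less_divide_eq)
    finally have "norm (D (x - p)) \<le> e * norm (x - p)" by (rule \<delta>1(2)[OF x(1)])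
    then have 1: "norm (D (x - p)) \<le> e * (t * (norm v + 1))"
      using xp e(1) by (smt (verit) mult_left_mono)
    have 2: "norm (D (x - p - t *\<^sub>R v)) \<le> e * t * K"
      using K(2)[of "x - p - t *\<^sub>R v"] x(2) K(1) by (smt (verit) mult_right_mono)
    have "D (t *\<^sub>R v) = D (x - p) - D (x - p - t *\<^sub>R v)"
      using linear_diff[OF bounded_linear.linear[OF bl], of "x - p" "x - p - t *\<^sub>R v"] by simp
    then have "norm (D (t *\<^sub>R v)) \<le> e * (t * (norm v + 1)) + e * t * K"
      using 1 2 norm_triangle_ineq4[of "D (x - p)" "D (x - p - t *\<^sub>R v)"] by simp
    moreover have "norm (D (t *\<^sub>R v)) = t * norm (D v)"
      using linear_cmul[OF bounded_linear.linear[OF bl]] t(1) by simp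
    ultimately have "t * norm (D v) \<le> t * (e * (norm v + 1 + K))" by (simp add: algebra_simps)
    then show ?thesis using t(1) by simp
  qed
  have "norm (D v) \<le> 0"
  proof (rule ccontr)
    assume neg: "\<not> norm (D v) \<le> 0"
    define C where "C = norm v + 1 + K"
    have C: "C > 0" using K(1) by (smt (verit) C_def norm_ge_zero)
    define e where "e = min 1 (norm (D v) / (2 * C))"
    have "0 < e" "e \<le> 1" using neg C by (auto simp: e_def)
    from bound[OF this] have "norm (D v) \<le> e * C" by (simp add: C_def)
    also have "\<dots> \<le> norm (D v) / (2 * C) * C" using C by (intro mult_right_mono) (auto simp: e_def)
    also have "\<dots> = norm (D v) / 2" using C by simp
    finally show False using neg by simp
  qed
  then show ?thesis by (simp add: D_def)
qed

section \<open>Functions of class \<open>C\<^sup>k\<close> on a submanifold\<close>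

lemma Ck_on_submanifold_subset:
  assumes "Ck_on_submanifold k f S" "T \<subseteq> S"
  shows "Ck_on_submanifold k f T"
  unfolding Ck_on_submanifold_def
proof
  fix p assume "p \<in> T"
  then obtain V g where "open V" "p \<in> V" "Ck_on k g V" "\<forall>x\<in>S \<inter> V. g x = f x"
    using assms unfolding Ck_on_submanifold_def by blast
  then show "\<exists>V g. open V \<and> p \<in> V \<and> Ck_on k g V \<and> (\<forall>x\<in>T \<inter> V. g x = f x)"
    using assms(2) by blast
qed

lemma Ck_on_submanifold_decr:
  assumes "Ck_on_submanifold k f S" "j \<le> k"
  shows "Ck_on_submanifold j f S"
  unfolding Ck_on_submanifold_def
proof
  fix p assume "p \<in> S"
  then obtain V g where "open V" "p \<in> V" "Ck_on k g V" "\<forall>x\<in>S \<inter> V. g x = f x"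
    using assms(1) unfolding Ck_on_submanifold_def by blast
  then show "\<exists>V g. open V \<and> p \<in> V \<and> Ck_on j g V \<and> (\<forall>x\<in>S \<inter> V. g x = f x)"
    using Ck_on_decr[OF _ assms(2)] by blast
qed

lemma Ck_on_submanifold_binary:
  fixes S :: "'a::euclidean_space set"
  assumes op: "\<And>(V :: 'a set) f g. open V \<Longrightarrow> Ck_on k f V \<Longrightarrow> Ck_on k g V \<Longrightarrow> Ck_on k (\<lambda>x. p (f x) (g x)) V"
    and "Ck_on_submanifold k f S" "Ck_on_submanifold k g S"
  shows "Ck_on_submanifold k (\<lambda>x. p (f x) (g x)) S"
  unfolding Ck_on_submanifold_def
proof
  fix q assume "q \<in> S"
  obtain V f' where V: "open V" "q \<in> V" "Ck_on k f' V" "\<forall>x\<in>S \<inter> V. f' x = f x"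
    using assms(2) \<open>q \<in> S\<close> unfolding Ck_on_submanifold_def by blast
  obtain V' g' where V': "open V'" "q \<in> V'" "Ck_on k g' V'" "\<forall>x\<in>S \<inter> V'. g' x = g x"
    using assms(3) \<open>q \<in> S\<close> unfolding Ck_on_submanifold_def by blast
  have "Ck_on k (\<lambda>x. p (f' x) (g' x)) (V \<inter> V')"
    by (intro op open_Int V V' Ck_on_subset[OF V(3)] Ck_on_subset[OF V'(3)]) auto
  then show "\<exists>V h. open V \<and> q \<in> V \<and> Ck_on k h V \<and> (\<forall>x\<in>S \<inter> V. h x = p (f x) (g x))"
    using V V' by (intro exI[of _ "V \<inter> V'"] exI[of _ "\<lambda>x. p (f' x) (g' x)"]) auto
qed

lemma Ck_on_submanifold_mult:
  fixes f g :: "'a::euclidean_space \<Rightarrow> complex"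
  shows "Ck_on_submanifold k f S \<Longrightarrow> Ck_on_submanifold k g S \<Longrightarrow>
    Ck_on_submanifold k (\<lambda>x. f x * g x) S"
  by (rule Ck_on_submanifold_binary[OF Ck_on_mult])

lemma Ck_on_submanifold_compose:
  fixes f :: "'b::euclidean_space \<Rightarrow> 'c::real_normed_vector" and g :: "'a::euclidean_space \<Rightarrow> 'b"
  assumes "Ck_on_submanifold k g S" "open V" "g ` S \<subseteq> V" "Ck_on k f V"
  shows "Ck_on_submanifold k (\<lambda>x. f (g x)) S"
  unfolding Ck_on_submanifold_def
proof
  fix q assume q: "q \<in> S"
  obtain U g' where U: "open U" "q \<in> U" "Ck_on k g' U" "\<forall>x\<in>S \<inter> U. g' x = g x"
    using assms(1) q unfolding Ck_on_submanifold_def by blast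
  define U' where "U' = U \<inter> g' -` V"
  have "open U'"
    using Ck_on_continuous[OF U(3)] U(1) assms(2) unfolding U'_def
    by (metis Int_commute continuous_on_open_vimage)
  moreover have "q \<in> U'" using U(2,4) q assms(3) by (auto simp: U'_def)
  moreover have "Ck_on k (\<lambda>x. f (g' x)) U'"
  proof (rule Ck_on_compose[OF \<open>open U'\<close> assms(2) _ _ assms(4)])
    show "g' ` U' \<subseteq> V" by (auto simp: U'_def)
    show "Ck_on k g' U'" using U(3) by (rule Ck_on_subset) (simp add: U'_def)
  qed
  moreover have "\<forall>x\<in>S \<inter> U'. f (g' x) = f (g x)" using U(4) by (simp add: U'_def)
  ultimately show "\<exists>V h. open V \<and> q \<in> V \<and> Ck_on k h V \<and> (\<forall>x\<in>S \<inter> V. h x = f (g x))"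
    by (intro exI[of _ U'] exI[of _ "\<lambda>x. f (g' x)"]) simp
qed

lemma has_derivative_within_cong_near:
  assumes "open W" "p \<in> M \<inter> W" "\<And>x. x \<in> M \<inter> W \<Longrightarrow> f x = g x"
    and "(f has_derivative D) (at p within M)"
  shows "(g has_derivative D) (at p within M)"
proof -
  obtain e where e: "e > 0" "ball p e \<subseteq> W" using assms(1,2) openE by blast
  show ?thesis
  proof (rule has_derivative_transform_within[OF assms(4) e(1)])
    show "f x = g x" if "x \<in> M" "dist x p < e" for x
      using that e(2) assms(3) by (auto simp: subset_iff dist_commute)
  qed (use assms(2) in auto)
qed

text \<open>Near each point, the derivative of an ambient extension serves as a derivative of \<open>f\<close> within \<open>M\<close>.\<close>

lemma Ck_on_submanifold_extension:
  fixes f :: "'a::euclidean_space \<Rightarrow> 'b::real_normed_vector"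
  assumes "Ck_on_submanifold (Suc k) f (M \<inter> W)" "open W" "p \<in> M \<inter> W"
  obtains V g where "open V" "p \<in> V" "V \<subseteq> W" "Ck_on (Suc k) g V"
    "\<And>x. x \<in> M \<inter> V \<Longrightarrow> g x = f x"
    "\<And>x. x \<in> M \<inter> V \<Longrightarrow> (f has_derivative frechet_derivative g (at x)) (at x within M)"
proof -
  obtain V g where V: "open V" "p \<in> V" "Ck_on (Suc k) g V" "\<forall>x\<in>M \<inter> W \<inter> V. g x = f x"
    using assms(1,3) unfolding Ck_on_submanifold_def by blast
  have VW: "open (V \<inter> W)" using V(1) assms(2) by blast
  show ?thesis
  proof (rule that[OF VW])
    fix x assume x: "x \<in> M \<inter> (V \<inter> W)"
    show "(f has_derivative frechet_derivative g (at x)) (at x within M)"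
    proof (rule has_derivative_within_cong_near[OF VW x])
      show "(g has_derivative frechet_derivative g (at x)) (at x within M)"
        using Ck_on_Suc_has_derivative[OF V(3)] x by (blast intro: has_derivative_at_withinI)
    qed (use V(4) in blast)
  next
    show "Ck_on (Suc k) g (V \<inter> W)" using V(3) by (rule Ck_on_subset) blast
  qed (use V assms(3) in auto)
qed

lemma Ck_on_submanifold_differentiable:
  assumes "Ck_on_submanifold (Suc k) f (M \<inter> W)" "open W" "p \<in> M \<inter> W"
  shows "f differentiable (at p within M)"
proof -
  obtain V g where "p \<in> V"
    "\<And>x. x \<in> M \<inter> V \<Longrightarrow> (f has_derivative frechet_derivative g (at x)) (at x within M)"
    using Ck_on_submanifold_extension[OF assms] by metis
  then show ?thesis using assms(3) by (auto intro: differentiableI)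
qed

section \<open>Action of CR vector fields\<close>

text \<open>The pointwise content of \<open>bar_field\<close>, with the derivative as an argument: it allows the derivative
  within \<open>M\<close> to be replaced by a more convenient one.\<close>

definition bar_deriv :: "complex^'n \<Rightarrow> (complex^'n \<Rightarrow> complex) \<Rightarrow> complex" where
  "bar_deriv a D = (\<Sum>j\<in>UNIV. a $ j * ((D (axis j 1) + \<i> * D (axis j \<i>)) / 2))"

lemma bar_field_eq_bar_deriv:
  "bar_field S a f p = bar_deriv (a p) (frechet_derivative f (at p within S))"
  by (simp add: bar_field_def bar_deriv_def)

abbreviation cnj_vec :: "complex^'n \<Rightarrow> complex^'n" where
  "cnj_vec a \<equiv> (\<chi> j. cnj (a $ j))"

text \<open>Only the values of \<open>D\<close> at the two real vectors that span the complex line of \<open>cnj a\<close> matter.\<close>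

lemma bar_deriv_eq_on_conjugate:
  assumes "linear D"
  shows "bar_deriv a D = (D (cnj_vec a) + \<i> * D (\<chi> j. \<i> * cnj (a $ j))) / 2"
proof -
  have "D (cnj_vec a) + \<i> * D (\<chi> j. \<i> * cnj (a $ j)) =
      (\<Sum>j\<in>UNIV. (of_real (Re (a $ j)) * D (axis j 1) - of_real (Im (a $ j)) * D (axis j \<i>)) +
        \<i> * (of_real (Im (a $ j)) * D (axis j 1) + of_real (Re (a $ j)) * D (axis j \<i>)))"
    unfolding real_linear_axis_expansion[OF assms, of "cnj_vec a"]
      real_linear_axis_expansion[OF assms, of "\<chi> j. \<i> * cnj (a $ j)"]
      sum_distrib_left sum.distrib[symmetric]
    by (intro sum.cong refl) (simp add: scaleR_conv_of_real)
  also have "\<dots> = (\<Sum>j\<in>UNIV. a $ j * (D (axis j 1) + \<i> * D (axis j \<i>)))"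
    by (intro sum.cong refl) (subst (5 6) complex_eq, simp add: algebra_simps)
  finally show ?thesis by (simp add: bar_deriv_def sum_divide_distrib)
qed

lemma cr_vector_field_on_open: "cr_vector_field_on M W a \<Longrightarrow> open W"
  by (simp add: cr_vector_field_on_def)

lemma cr_vector_field_on_subset:
  assumes "cr_vector_field_on M U a" "open W" "W \<subseteq> U"
  shows "cr_vector_field_on M W a"
  unfolding cr_vector_field_on_def
proof (intro conjI ballI)
  show "smooth_on_submanifold a (M \<inter> W)"
    unfolding smooth_on_submanifold_def
  proof
    fix p assume "p \<in> M \<inter> W"
    then obtain V g where "open V" "p \<in> V" "smooth_on g V" "\<forall>x\<in>M \<inter> U \<inter> V. g x = a x"
      using assms unfolding cr_vector_field_on_def smooth_on_submanifold_def by blast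
    then show "\<exists>V g. open V \<and> p \<in> V \<and> smooth_on g V \<and> (\<forall>x\<in>M \<inter> W \<inter> V. g x = a x)"
      using assms(3) by blast
  qed
  show "\<exists>d \<rho>. local_defining_function M d p \<rho> \<and>
      (\<forall>j<d. bar_field UNIV a (\<lambda>Z. complex_of_real (\<rho> j Z)) p = 0)" if "p \<in> M \<inter> W" for p
    using assms(1,3) that unfolding cr_vector_field_on_def by blast
qed (rule assms(2))

text \<open>Tangency of \<open>\<Sum>\<^sub>j a\<^sub>j \<partial>/\<partial>Z\<^sup>-\<^sub>j\<close> is the conjugate of the equation below; the equation being complex
  linear in \<open>cnj a\<close>, both \<open>cnj a\<close> and \<open>\<i> cnj a\<close> are real tangent vectors.\<close>

lemma cr_vector_field_tangent:
  assumes "cr_vector_field_on M W a" "p \<in> M \<inter> W"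
  obtains d \<rho> V where "smooth_defining M d V \<rho>" "p \<in> V"
    "\<And>j. j < d \<Longrightarrow> pairing (complex_gradient (\<rho> j) p) (cnj_vec (a p)) = 0"
proof -
  obtain d \<rho> where "local_defining_function M d p \<rho>"
    and tangent: "\<forall>j<d. bar_field UNIV a (\<lambda>Z. complex_of_real (\<rho> j Z)) p = 0"
    using assms unfolding cr_vector_field_on_def by blast
  then obtain V where V: "p \<in> V" "smooth_defining M d V \<rho>"
    using local_defining_imp_smooth by blast
  have "pairing (complex_gradient (\<rho> j) p) (cnj_vec (a p)) = 0" if "j < d" for j
  proof -
    have "Ck_on (Suc 0) (\<rho> j) V" 
      using V(2) that unfolding smooth_defining_def smooth_on_def by blast
    then obtain D where D: "(\<rho> j has_derivative D) (at p)"
      using Ck_on_Suc_has_derivative V(1) by blast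
    have "cnj (pairing (complex_gradient (\<rho> j) p) (cnj_vec (a p)))
        = bar_field UNIV a (\<lambda>Z. complex_of_real (\<rho> j Z)) p"
      by (simp add: bar_field_def frechet_derivative_of_real[OF D] complex_gradient_nth[OF D]
          mult.commute)
    also have "\<dots> = 0" using tangent that by blast
    finally show ?thesis by (simp only: complex_cnj_zero_iff)
  qed
  then show ?thesis using that V by blast
qed

text \<open>The action of a CR vector field may be computed with any derivative within \<open>M\<close>, because it only
  evaluates the derivative at tangent vectors.\<close>

lemma bar_field_eq:
  assumes "cr_vector_field_on M W a" "p \<in> M \<inter> W" "(f has_derivative D) (at p within M)"
  shows "bar_field M a f p = bar_deriv (a p) D"
proof -
  let ?D = "frechet_derivative f (at p within M)"
  have D': "(f has_derivative ?D) (at p within M)"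
    using assms(3) frechet_derivative_works differentiableI by blast
  obtain d \<rho> V where V: "smooth_defining M d V \<rho>" "p \<in> V"
    and tangent: "\<And>j. j < d \<Longrightarrow> pairing (complex_gradient (\<rho> j) p) (cnj_vec (a p)) = 0"
    using cr_vector_field_tangent[OF assms(1,2)] by metis
  have uniq: "?D v = D v" if "\<And>j. j < d \<Longrightarrow> Re (pairing (complex_gradient (\<rho> j) p) v) = 0" for v
    using derivative_within_unique_on_tangent[OF V(1) _ V(2) that D' assms(3)] assms(2) by blast
  have rot: "pairing (complex_gradient (\<rho> j) p) (\<chi> i. \<i> * cnj (a p $ i))
      = \<i> * pairing (complex_gradient (\<rho> j) p) (cnj_vec (a p))" for j
    by (simp add: sum_distrib_left mult_ac)
  have "?D (cnj_vec (a p)) = D (cnj_vec (a p))"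
    by (rule uniq) (simp only: tangent zero_complex.sel)
  moreover have "?D (\<chi> i. \<i> * cnj (a p $ i)) = D (\<chi> i. \<i> * cnj (a p $ i))"
    by (rule uniq) (simp only: rot tangent mult_zero_right zero_complex.sel)
  ultimately show ?thesis
    unfolding bar_field_eq_bar_deriv
      bar_deriv_eq_on_conjugate[OF has_derivative_linear[OF D']]
      bar_deriv_eq_on_conjugate[OF has_derivative_linear[OF assms(3)]] by simp
qed

lemma bar_field_cong:
  assumes "open W" "p \<in> M \<inter> W" "\<And>x. x \<in> M \<inter> W \<Longrightarrow> f x = g x"
  shows "bar_field M a f p = bar_field M a g p"
proof -
  have "(f has_derivative D) (at p within M) \<longleftrightarrow> (g has_derivative D) (at p within M)" for D
    using has_derivative_within_cong_near[OF assms(1,2)] assms(3) by metis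
  then show ?thesis by (simp add: bar_field_eq_bar_deriv frechet_derivative_def)
qed

lemma bar_field_mult:
  assumes cr: "cr_vector_field_on M W a" "p \<in> M \<inter> W"
    and "f differentiable (at p within M)" "g differentiable (at p within M)"
  shows "bar_field M a (\<lambda>x. f x * g x) p = bar_field M a f p * g p + f p * bar_field M a g p"
proof -
  obtain D E where D: "(f has_derivative D) (at p within M)" and E: "(g has_derivative E) (at p within M)"
    using assms(3,4) by (auto simp: differentiable_def)
  show ?thesis
    unfolding bar_field_eq[OF cr D] bar_field_eq[OF cr E] bar_field_eq[OF cr has_derivative_mult[OF D E]]
      bar_deriv_def sum_distrib_left sum_distrib_right sum.distrib[symmetric]
    by (intro sum.cong refl) (simp add: field_simps)
qed

lemma bar_field_sum:
  assumes cr: "cr_vector_field_on M W a" "p \<in> M \<inter> W"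
    and "\<And>i. i \<in> I \<Longrightarrow> f i differentiable (at p within M)"
  shows "bar_field M a (\<lambda>x. \<Sum>i\<in>I. f i x) p = (\<Sum>i\<in>I. bar_field M a (f i) p)"
proof -
  have D: "(f i has_derivative frechet_derivative (f i) (at p within M)) (at p within M)" if "i \<in> I" for i
    using assms(3)[OF that] frechet_derivative_works by blast
  have "bar_field M a (\<lambda>x. \<Sum>i\<in>I. f i x) p
      = bar_deriv (a p) (\<lambda>v. \<Sum>i\<in>I. frechet_derivative (f i) (at p within M) v)"
    by (rule bar_field_eq[OF cr has_derivative_sum[OF D]])
  also have "\<dots> = (\<Sum>i\<in>I. bar_deriv (a p) (frechet_derivative (f i) (at p within M)))"
    unfolding bar_deriv_def
    by (subst sum.swap, intro sum.cong refl)
      (simp add: sum_distrib_left sum.distrib[symmetric] sum_divide_distrib)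
  finally show ?thesis by (simp add: bar_field_eq_bar_deriv)
qed

text \<open>On \<open>M\<close>, the derivative \<open>L f\<close> agrees with the expression formed from ambient extensions of \<open>f\<close> and of
  the coefficients of \<open>L\<close>, and that expression is visibly one order less regular than \<open>f\<close>.\<close>

lemma Ck_on_submanifold_bar_field:
  assumes cr: "cr_vector_field_on M W a" and f: "Ck_on_submanifold (Suc k) f (M \<inter> W)"
  shows "Ck_on_submanifold k (bar_field M a f) (M \<inter> W)"
  unfolding Ck_on_submanifold_def
proof
  fix p assume p: "p \<in> M \<inter> W"
  obtain V g where V: "open V" "p \<in> V" "V \<subseteq> W" "Ck_on (Suc k) g V"
    and Dg: "\<And>x. x \<in> M \<inter> V \<Longrightarrow> (f has_derivative frechet_derivative g (at x)) (at x within M)"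
    using Ck_on_submanifold_extension[OF f cr_vector_field_on_open[OF cr] p] by metis
  obtain V' a' where V': "open V'" "p \<in> V'" "smooth_on a' V'" "\<forall>x\<in>M \<inter> W \<inter> V'. a' x = a x"
    using cr p unfolding cr_vector_field_on_def smooth_on_submanifold_def by blast
  let ?U = "V \<inter> V'" and ?h = "\<lambda>x. bar_deriv (a' x) (frechet_derivative g (at x))"
  have U: "open ?U" using V V' by blast
  have a': "Ck_on k (\<lambda>x. a' x $ j) ?U" for j
  proof (rule Ck_on_vec_nth[OF U])
    show "Ck_on k a' ?U" 
      using V'(3)[unfolded smooth_on_def, THEN spec, of k] by (rule Ck_on_subset) simp
  qed
  have Dk: "Ck_on k (\<lambda>x. frechet_derivative g (at x) v) ?U" for v
  proof (rule Ck_on_subset)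
    show "Ck_on k (\<lambda>x. frechet_derivative g (at x) v) V" using V(4) by simp
  qed simp
  have Ck: "Ck_on k (\<lambda>x. \<Sum>j\<in>UNIV. a' x $ j * ((1/2) *
      (frechet_derivative g (at x) (axis j 1) + \<i> * frechet_derivative g (at x) (axis j \<i>)))) ?U"
    by (intro Ck_on_sum[OF U] Ck_on_mult[OF U] Ck_on_add[OF U] a' Dk Ck_on_const)
  then have "Ck_on k ?h ?U" by (simp add: bar_deriv_def)
  moreover have "?h x = bar_field M a f x" if "x \<in> M \<inter> W \<inter> ?U" for x
    using bar_field_eq[OF cr _ Dg, of x] that V'(4) by auto
  ultimately show "\<exists>V h. open V \<and> p \<in> V \<and> Ck_on k h V \<and> (\<forall>x\<in>M \<inter> W \<inter> V. h x = bar_field M a f x)"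
    using U V(2) V'(2) by (intro exI[of _ ?U] exI[of _ ?h]) blast
qed

lemma iterated_bar_field_cong:
  assumes "open W" "\<And>x. x \<in> M \<inter> W \<Longrightarrow> f x = g x" "x \<in> M \<inter> W"
  shows "foldr (bar_field M) Ls f x = foldr (bar_field M) Ls g x"
  using assms(3)
proof (induction Ls arbitrary: x)
  case (Cons L Ls)
  show ?case
    using bar_field_cong[OF assms(1) Cons.prems Cons.IH] by simp
qed (use assms(2) in simp)

lemma Ck_on_submanifold_iterated_bar_field:
  assumes "\<forall>L\<in>set Ls. cr_vector_field_on M W L"
    and "Ck_on_submanifold (length Ls + k) f (M \<inter> W)"
  shows "Ck_on_submanifold k (foldr (bar_field M) Ls f) (M \<inter> W)"
  using assms
proof (induction Ls arbitrary: k)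
  case (Cons L Ls)
  have "Ck_on_submanifold (Suc k) (foldr (bar_field M) Ls f) (M \<inter> W)"
    using Cons by simp
  from Ck_on_submanifold_bar_field[OF _ this, of L] show ?case
    using Cons.prems(1) by simp
qed simp

lemma iterated_bar_field_differentiable:
  assumes "open W" "\<forall>L\<in>set Ls. cr_vector_field_on M W L"
    and "Ck_on_submanifold (Suc (length Ls)) f (M \<inter> W)" "x \<in> M \<inter> W"
  shows "foldr (bar_field M) Ls f differentiable (at x within M)"
proof -
  have "Ck_on_submanifold (Suc 0) (foldr (bar_field M) Ls f) (M \<inter> W)"
    using assms(3) by (intro Ck_on_submanifold_iterated_bar_field[OF assms(2)]) simp
  then show ?thesis by (rule Ck_on_submanifold_differentiable[OF _ assms(1,4)])
qed

lemma iterated_bar_field_sum: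
  assumes "open W" "\<forall>L\<in>set Ls. cr_vector_field_on M W L"
    and "\<And>i. i \<in> I \<Longrightarrow> Ck_on_submanifold (length Ls) (f i) (M \<inter> W)" "x \<in> M \<inter> W"
  shows "foldr (bar_field M) Ls (\<lambda>x. \<Sum>i\<in>I. f i x) x = (\<Sum>i\<in>I. foldr (bar_field M) Ls (f i) x)"
  using assms(2-4)
proof (induction Ls arbitrary: x)
  case (Cons L Ls)
  have Ck: "Ck_on_submanifold (length Ls) (f i) (M \<inter> W)" if "i \<in> I" for i
    using Ck_on_submanifold_decr[OF Cons.prems(2)[OF that], of "length Ls"] by simp
  have cr: "\<forall>L\<in>set Ls. cr_vector_field_on M W L" using Cons.prems(1) by simp
  have "foldr (bar_field M) (L # Ls) (\<lambda>x. \<Sum>i\<in>I. f i x) x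
      = bar_field M L (\<lambda>x. \<Sum>i\<in>I. foldr (bar_field M) Ls (f i) x) x"
    using bar_field_cong[OF assms(1) Cons.prems(3) Cons.IH[OF cr Ck]] by simp
  also have "\<dots> = (\<Sum>i\<in>I. bar_field M L (foldr (bar_field M) Ls (f i)) x)"
    using Cons.prems
    by (intro bar_field_sum[where W = W] iterated_bar_field_differentiable[OF assms(1)]) simp_all
  finally show ?case by simp
qed simp

lemma iterated_bar_field_add:
  assumes "open W" "\<forall>L\<in>set Ls. cr_vector_field_on M W L"
    and "Ck_on_submanifold (length Ls) f (M \<inter> W)" "Ck_on_submanifold (length Ls) g (M \<inter> W)"
    and "x \<in> M \<inter> W"
  shows "foldr (bar_field M) Ls (\<lambda>x. f x + g x) x
    = foldr (bar_field M) Ls f x + foldr (bar_field M) Ls g x"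
  using iterated_bar_field_sum[OF assms(1,2), of UNIV "\<lambda>b. if b then f else g" x] assms(3-5)
  by (simp add: UNIV_bool add.commute split: if_splits)

text \<open>A CR factor \<open>J\<close> behaves like a constant: by the Leibniz rule and \<open>L J = 0\<close> it moves out of
  \<open>L\<^sub>1 \<cdots> L\<^sub>j (f J)\<close> past one field at a time.\<close>

lemma iterated_bar_field_mult_CR:
  assumes "open W" "\<forall>L\<in>set Ls. cr_vector_field_on M W L"
    and "Ck_on_submanifold (length Ls) f (M \<inter> W)"
    and "\<And>L x. L \<in> set Ls \<Longrightarrow> x \<in> M \<inter> W \<Longrightarrow>
      J differentiable (at x within M) \<and> bar_field M L J x = 0"
    and "x \<in> M \<inter> W"
  shows "foldr (bar_field M) Ls (\<lambda>x. f x * J x) x = foldr (bar_field M) Ls f x * J x"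
  using assms(2-5)
proof (induction Ls arbitrary: x)
  case (Cons L Ls)
  have Ck: "Ck_on_submanifold (length Ls) f (M \<inter> W)"
    using Ck_on_submanifold_decr[OF Cons.prems(2), of "length Ls"] by simp
  have cr: "\<forall>L\<in>set Ls. cr_vector_field_on M W L" "cr_vector_field_on M W L"
    using Cons.prems(1) by simp_all
  have J: "J differentiable (at x within M) \<and> bar_field M L' J x = 0"
    if "L' \<in> set Ls" "x \<in> M \<inter> W" for L' x
    by (rule Cons.prems(3)) (use that in simp_all)
  note IH = Cons.IH[OF cr(1) Ck J]
  have "foldr (bar_field M) (L # Ls) (\<lambda>x. f x * J x) x
      = bar_field M L (\<lambda>x. foldr (bar_field M) Ls f x * J x) x"
    unfolding foldr.simps comp_def by (rule bar_field_cong[OF assms(1) Cons.prems(4) IH])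
  also have "\<dots> = bar_field M L (foldr (bar_field M) Ls f) x * J x
      + foldr (bar_field M) Ls f x * bar_field M L J x"
  proof (rule bar_field_mult[OF cr(2) Cons.prems(4)])
    show "foldr (bar_field M) Ls f differentiable (at x within M)"
      using Cons.prems(2,4) by (intro iterated_bar_field_differentiable[OF assms(1) cr(1)]) simp_all
    show "J differentiable (at x within M)" using Cons.prems(3)[of L x] Cons.prems(4) by simp
  qed
  finally show ?case using Cons.prems(3)[of L x] Cons.prems(4) by simp
qed simp

text \<open>Leibniz rule for \<open>L\<^sub>1 \<cdots> L\<^sub>j (a u)\<close> at a point, keeping track only of which derivatives of \<open>u\<close> occur.
  The induction splits off the innermost field, since \<open>L (a u) = (L a) u + a (L u)\<close> is a sum of two
  products of the same kind, with data of one order less.\<close>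

lemma iterated_bar_field_mult_in_span:
  fixes u :: "'m::finite \<Rightarrow> complex^'n \<Rightarrow> complex"
  assumes "open W" "p \<in> M \<inter> W" "\<forall>L\<in>set Ls. cr_vector_field_on M W L"
    and "Ck_on_submanifold (length Ls) a (M \<inter> W)"
    and "\<And>i. Ck_on_submanifold (length Ls) (u i) (M \<inter> W)"
  shows "(\<chi> i. foldr (bar_field M) Ls (\<lambda>x. a x * u i x) p) \<in> vec.span
    {(\<chi> i. foldr (bar_field M) Ks (u i) p) | Ks. set Ks \<subseteq> set Ls \<and> length Ks \<le> length Ls}"
  using assms(3-5)
proof (induction Ls arbitrary: a u rule: rev_induct)
  case Nil
  have "(\<chi> i. a p * u i p) = a p *s (\<chi> i. u i p)" by (simp add: vec_eq_iff)
  moreover have "(\<chi> i. u i p) \<in> vec.span {(\<chi> i. foldr (bar_field M) Ks (u i) p) | Ks.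
      set Ks \<subseteq> set [] \<and> length Ks \<le> length []}"
    by (intro vec.span_base) auto
  ultimately show ?case by (simp add: vec.span_scale)
next
  case (snoc L Ls)
  let ?gen = "\<lambda>u Ls. {(\<chi> i. foldr (bar_field M) Ks (u i) p) | Ks.
      set Ks \<subseteq> set Ls \<and> length Ks \<le> length Ls} :: (complex^'m) set"
  have cr: "\<forall>L\<in>set Ls. cr_vector_field_on M W L" "cr_vector_field_on M W L"
    using snoc.prems(1) by simp_all
  have a: "Ck_on_submanifold (Suc (length Ls)) a (M \<inter> W)"
    and u: "Ck_on_submanifold (Suc (length Ls)) (u i) (M \<inter> W)" for i
    using snoc.prems(2,3) by simp_all
  note decr = Ck_on_submanifold_decr[where k = "Suc (length Ls)" and j = "length Ls"]
  have a': "Ck_on_submanifold (length Ls) a (M \<inter> W)" using decr[OF a] by simp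
  have u': "Ck_on_submanifold (length Ls) (u i) (M \<inter> W)" for i using decr[OF u] by simp
  note La = Ck_on_submanifold_bar_field[OF cr(2) a]
  note Lu = Ck_on_submanifold_bar_field[OF cr(2) u]
  have product: "bar_field M L (\<lambda>x. a x * u i x) x
      = bar_field M L a x * u i x + a x * bar_field M L (u i) x" if "x \<in> M \<inter> W" for i x
    by (intro bar_field_mult[OF cr(2) that]
        Ck_on_submanifold_differentiable[OF a assms(1) that]
        Ck_on_submanifold_differentiable[OF u assms(1) that])
  have "foldr (bar_field M) (Ls @ [L]) (\<lambda>x. a x * u i x) p
      = foldr (bar_field M) Ls (\<lambda>x. bar_field M L a x * u i x + a x * bar_field M L (u i) x) p" for i
    using iterated_bar_field_cong[OF assms(1) product assms(2)] by simp
  also have "foldr (bar_field M) Ls (\<lambda>x. bar_field M L a x * u i x + a x * bar_field M L (u i) x) p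
      = foldr (bar_field M) Ls (\<lambda>x. bar_field M L a x * u i x) p
      + foldr (bar_field M) Ls (\<lambda>x. a x * bar_field M L (u i) x) p" for i
    by (intro iterated_bar_field_add[OF assms(1) cr(1) _ _ assms(2)]
        Ck_on_submanifold_mult a' u' La Lu)
  finally have split: "(\<chi> i. foldr (bar_field M) (Ls @ [L]) (\<lambda>x. a x * u i x) p)
      = (\<chi> i. foldr (bar_field M) Ls (\<lambda>x. bar_field M L a x * u i x) p)
      + (\<chi> i. foldr (bar_field M) Ls (\<lambda>x. a x * bar_field M L (u i) x) p)"
    by (simp add: vec_eq_iff)
  have sub: "?gen u Ls \<subseteq> ?gen u (Ls @ [L])" by fastforce
  have sub': "?gen (\<lambda>i. bar_field M L (u i)) Ls \<subseteq> ?gen u (Ls @ [L])"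
  proof
    fix v assume "v \<in> ?gen (\<lambda>i. bar_field M L (u i)) Ls"
    then obtain Ks where "v = (\<chi> i. foldr (bar_field M) (Ks @ [L]) (u i) p)"
      "set Ks \<subseteq> set Ls" "length Ks \<le> length Ls" by auto
    then show "v \<in> ?gen u (Ls @ [L])"
      by (intro CollectI exI[of _ "Ks @ [L]"]) auto
  qed
  show ?case
    unfolding split
    by (rule vec.span_add[OF subsetD[OF vec.span_mono[OF sub] snoc.IH[OF cr(1) La u']]
          subsetD[OF vec.span_mono[OF sub'] snoc.IH[OF cr(1) a' Lu]]])
qed

section \<open>Change of the defining function\<close>

lemma smooth_defining_mono:
  assumes "smooth_defining M d V \<rho>" "open V'" "V' \<subseteq> V"
  shows "smooth_defining M d V' \<rho>"
  unfolding smooth_defining_def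
proof (intro conjI)
  show "M \<inter> V' = {Z \<in> V'. \<forall>j<d. \<rho> j Z = 0}"
    using assms(1,3) unfolding smooth_defining_def by blast
  show "\<forall>j<d. smooth_on (\<rho> j) V'"
    using assms(1,3) Ck_on_subset unfolding smooth_defining_def smooth_on_def by blast
  show "\<forall>Z\<in>V'. \<forall>c. (\<Sum>j<d. c j *s complex_gradient (\<rho> j) Z) = 0 \<longrightarrow> (\<forall>j<d. c j = 0)"
    using assms(1,3) unfolding smooth_defining_def by blast
qed (rule assms(2))

text \<open>A function vanishing on \<open>M\<close> has the derivative \<open>0\<close> within \<open>M\<close>, so its differential vanishes on the
  common kernel of the differentials of the \<open>\<rho> j\<close> and is a real combination of them. Pairing with dual
  vectors recovers the coefficients.\<close>

lemma gradient_in_span_of_defining_gradients: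
  fixes M :: "(complex^'m) set"
  assumes sd: "smooth_defining M d V \<rho>" and q: "q \<in> M" "q \<in> V"
    and \<tau>: "(\<tau> has_derivative D) (at q)" "\<And>Z. Z \<in> M \<inter> V \<Longrightarrow> \<tau> Z = 0"
    and dual: "\<And>i j. i < d \<Longrightarrow> j < d \<Longrightarrow>
      pairing (complex_gradient (\<rho> i) q) (y j) = (if i = j then 1 else 0)"
  shows "complex_gradient \<tau> q
    = (\<Sum>j<d. pairing (complex_gradient \<tau> q) (y j) *s complex_gradient (\<rho> j) q)"
proof -
  let ?g = "\<lambda>j. complex_gradient (\<rho> j) q"
  have V: "open V" using sd by (simp add: smooth_defining_def)
  have lin: "linear D" using \<tau>(1) by (rule has_derivative_linear)
  have "((\<lambda>Z. 0) has_derivative D) (at q within M)"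
    using has_derivative_within_cong_near[OF V, of q M \<tau> "\<lambda>Z. 0" D] q \<tau>
    by (simp add: has_derivative_at_withinI)
  then have tangent: "D v = 0" if "\<And>j. j < d \<Longrightarrow> Re (pairing (?g j) v) = 0" for v
    using derivative_within_unique_on_tangent[OF sd q that] has_derivative_const by blast
  have pairing_sum: "pairing g (\<Sum>j<d. r j *\<^sub>R y j) = (\<Sum>j<d. complex_of_real (r j) * pairing g (y j))"
    for g :: "complex^'m" and r :: "nat \<Rightarrow> real"
    unfolding sum_component vector_scaleR_component sum_distrib_left
    by (subst sum.swap) (simp add: scaleR_conv_of_real mult_ac sum_distrib_left)
  define c where "c j = complex_of_real (D (y j) / 2)" for j
  have D: "D v = 2 * Re (pairing (\<Sum>j<d. c j *s ?g j) v)" for v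
  proof -
    define r where "r j = Re (pairing (?g j) v)" for j
    have "Re (pairing (?g i) (v - (\<Sum>j<d. r j *\<^sub>R y j))) = 0" if "i < d" for i
    proof -
      have "pairing (?g i) (v - (\<Sum>j<d. r j *\<^sub>R y j))
          = pairing (?g i) v - pairing (?g i) (\<Sum>j<d. r j *\<^sub>R y j)"
        by (simp only: vector_minus_component right_diff_distrib sum_subtractf)
      also have "pairing (?g i) (\<Sum>j<d. r j *\<^sub>R y j) = (\<Sum>j<d. if j = i then complex_of_real (r j) else 0)"
        unfolding pairing_sum using dual[OF that] by (intro sum.cong) auto
      also have "\<dots> = of_real (r i)" using that by simp
      finally show ?thesis by (simp add: r_def)
    qed
    from tangent[OF this] have "D v = D (\<Sum>j<d. r j *\<^sub>R y j)"
      using linear_diff[OF lin] by simp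
    also have "\<dots> = (\<Sum>j<d. r j * D (y j))"
      using lin by (simp add: linear_sum linear_cmul)
    also have "\<dots> = (\<Sum>j<d. 2 * Re (c j * pairing (?g j) v))"
      by (intro sum.cong refl) (simp add: c_def r_def[symmetric] del: Re_sum)
    also have "\<dots> = 2 * Re (\<Sum>j<d. c j * pairing (?g j) v)"
      by (simp only: Re_sum sum_distrib_left)
    also have "(\<Sum>j<d. c j * pairing (?g j) v) = pairing (\<Sum>j<d. c j *s ?g j) v"
      unfolding sum_component vector_smult_component sum_distrib_left sum_distrib_right
      by (subst sum.swap) (simp add: mult.assoc)
    finally show ?thesis .
  qed
  have grad: "complex_gradient \<tau> q = (\<Sum>j<d. c j *s ?g j)"
    using \<tau>(1) unfolding ext[OF D] by (rule complex_gradient_eqI)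
  have "pairing (complex_gradient \<tau> q) (y j) = c j" if "j < d" for j
  proof -
    have "pairing (complex_gradient \<tau> q) (y j) = (\<Sum>i<d. c i * pairing (?g i) (y j))"
      unfolding grad sum_component vector_smult_component sum_distrib_left sum_distrib_right
      by (subst sum.swap) (simp add: mult.assoc)
    also have "\<dots> = (\<Sum>i<d. if i = j then c i else 0)"
      using dual[OF _ that] by (intro sum.cong) auto
    also have "\<dots> = c j" using that by simp
    finally show ?thesis .
  qed
  then have "(\<Sum>j<d. pairing (complex_gradient \<tau> q) (y j) *s ?g j) = (\<Sum>j<d. c j *s ?g j)"
    by (intro sum.cong) auto
  then show ?thesis using grad by simp
qed

text \<open>Vectors dual to the gradients at \<open>q0\<close> are transported to nearby points \<open>q\<close>: the matrix \<open>A q\<close> below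
  satisfies \<open>pairing (g i q0) (A q *v v) = pairing (g i q) v\<close> and is the identity at \<open>q0\<close>, so
  \<open>y j q = (A q)\<^sup>-\<^sup>1 x j\<close> is dual to the gradients at \<open>q\<close>. Cramer's rule shows that it depends smoothly on \<open>q\<close>.\<close>

lemma smooth_dual_vectors:
  fixes M :: "(complex^'m) set"
  assumes sd: "smooth_defining M d V \<rho>" and "q0 \<in> V"
  obtains V' y where "open V'" "q0 \<in> V'" "V' \<subseteq> V"
    "\<And>k j i. Ck_on k (\<lambda>q. y j q $ i) V'"
    "\<And>q i j. q \<in> V' \<Longrightarrow> i < d \<Longrightarrow> j < d \<Longrightarrow>
      pairing (complex_gradient (\<rho> i) q) (y j q) = (if i = j then 1 else 0)"
proof -
  define g where "g j q = complex_gradient (\<rho> j) q" for j q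
  have V: "open V" using sd by (simp add: smooth_defining_def)
  have Ckg: "Ck_on k (\<lambda>q. g j q $ i) V" if "j < d" for j i k
  proof -
    have "Ck_on (Suc k) (\<rho> j) V"
      using sd that unfolding smooth_defining_def smooth_on_def by blast
    then show ?thesis unfolding g_def by (rule Ck_on_complex_gradient[OF V])
  qed
  obtain x where x: "\<forall>i<d. \<forall>j<d. pairing (g i q0) (x j) = (if i = j then 1 else 0)"
    using dual_vectors[where d = d and g = "\<lambda>j. g j q0"] sd \<open>q0 \<in> V\<close>
    unfolding smooth_defining_def g_def by blast
  define A :: "complex^'m \<Rightarrow> complex^'m^'m" where
    "A q = (\<chi> i k. (if i = k then 1 else 0) + (\<Sum>j<d. (g j q $ k + (- g j q0 $ k)) * x j $ i))" for q
  have A_mult: "A q *v v = v + (\<Sum>j<d. (pairing (g j q) v - pairing (g j q0) v) *s x j)" for q v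
  proof -
    have "(A q *v v) $ i = v $ i + (\<Sum>j<d. (pairing (g j q) v - pairing (g j q0) v) * x j $ i)" for i
    proof -
      have "(A q *v v) $ i = (\<Sum>k\<in>UNIV. (if i = k then v $ k else 0)
          + (\<Sum>j<d. (g j q $ k * v $ k - g j q0 $ k * v $ k) * x j $ i))"
        unfolding A_def matrix_vector_mult_def
        by (simp add: distrib_right sum_distrib_right) (intro sum.cong refl, simp add: algebra_simps)
      also have "\<dots> = v $ i + (\<Sum>j<d. \<Sum>k\<in>UNIV. (g j q $ k * v $ k - g j q0 $ k * v $ k) * x j $ i)"
        by (simp add: sum.distrib sum.swap[of _ UNIV])
      finally show ?thesis by (simp add: sum_distrib_right sum_subtractf left_diff_distrib)
    qed
    then show ?thesis
      by (simp only: vec_eq_iff vector_add_component sum_component vector_smult_component) blast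
  qed
  have pull: "pairing (g i q0) (A q *v v) = pairing (g i q) v" if "i < d" for i q v
  proof -
    let ?r = "\<lambda>j. pairing (g j q) v - pairing (g j q0) v"
    have "pairing (g i q0) (A q *v v) = pairing (g i q0) v + pairing (g i q0) (\<Sum>j<d. ?r j *s x j)"
      unfolding A_mult by (simp only: vector_add_component distrib_left sum.distrib)
    also have "pairing (g i q0) (\<Sum>j<d. ?r j *s x j) = (\<Sum>j<d. ?r j * pairing (g i q0) (x j))"
      unfolding sum_component vector_smult_component sum_distrib_left
      by (subst sum.swap) (simp add: mult_ac)
    also have "\<dots> = (\<Sum>j<d. if j = i then ?r j else 0)"
      using x that by (intro sum.cong) auto
    also have "\<dots> = ?r i" using that by simp
    finally show ?thesis by simp
  qed
  have CkA: "Ck_on k (\<lambda>q. A q $ i $ l) V" for k i l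
    unfolding A_def vec_lambda_beta
    by (intro Ck_on_add[OF V] Ck_on_sum[OF V] Ck_on_mult[OF V] Ck_on_const) (simp add: Ckg)
  have Ckdet: "Ck_on k (\<lambda>q. det (A q)) V" for k
    by (rule Ck_on_det[OF V CkA])
  define V' where "V' = V \<inter> (\<lambda>q. det (A q)) -` (- {0})"
  have "open V'"
    unfolding V'_def by (intro continuous_open_preimage Ck_on_continuous[OF Ckdet] V) auto
  have V'V: "V' \<subseteq> V" by (simp add: V'_def)
  have "A q0 = mat 1" by (simp add: A_def mat_def vec_eq_iff)
  then have "q0 \<in> V'" using \<open>q0 \<in> V\<close> by (simp add: V'_def)
  define y where "y j q = (\<chi> l. det (\<chi> i k. if k = l then x j $ i else A q $ i $ k) / det (A q))" for j q
  show ?thesis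
  proof (rule that[OF \<open>open V'\<close> \<open>q0 \<in> V'\<close> V'V])
    fix k :: nat and j i
    have "Ck_on k (\<lambda>q. (\<chi> a b. if b = i then x j $ a else A q $ a $ b) $ a $ b) V'" for a b
      using Ck_on_subset[OF CkA V'V] by (cases "b = i") (simp_all add: Ck_on_const)
    then have "Ck_on k (\<lambda>q. det (\<chi> a b. if b = i then x j $ a else A q $ a $ b)) V'"
      by (rule Ck_on_det[OF \<open>open V'\<close>])
    moreover have "Ck_on k (\<lambda>q. inverse (det (A q))) V'"
      by (rule Ck_on_inverse[OF \<open>open V'\<close> Ck_on_subset[OF Ckdet V'V]]) (simp add: V'_def)
    ultimately have "Ck_on k (\<lambda>q. det (\<chi> a b. if b = i then x j $ a else A q $ a $ b)
        * inverse (det (A q))) V'"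
      by (rule Ck_on_mult[OF \<open>open V'\<close>])
    then show "Ck_on k (\<lambda>q. y j q $ i) V'" by (simp add: y_def divide_inverse)
  next
    fix q i j assume q: "q \<in> V'" and ij: "i < d" "j < d"
    have "A q *v y j q = x j"
      using q cramer[of "A q" "y j q" "x j"] by (simp add: V'_def y_def)
    then have "pairing (g i q) (y j q) = pairing (g i q0) (x j)"
      using pull[OF ij(1), of q "y j q"] by simp
    then show "pairing (complex_gradient (\<rho> i) q) (y j q) = (if i = j then 1 else 0)"
      using x ij by (simp add: g_def)
  qed
qed

lemma gradient_coefficients:
  fixes M :: "(complex^'m) set"
  assumes sd: "smooth_defining M d V \<rho>" and "q0 \<in> V"
    and \<tau>: "smooth_on \<tau> V" "\<And>Z. Z \<in> M \<inter> V \<Longrightarrow> \<tau> Z = 0"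
  obtains V' a where "open V'" "q0 \<in> V'" "V' \<subseteq> V" "\<And>k j. Ck_on k (a j) V'"
    "\<And>q. q \<in> M \<inter> V' \<Longrightarrow> complex_gradient \<tau> q = (\<Sum>j<d. a j q *s complex_gradient (\<rho> j) q)"
proof -
  obtain V' y where V': "open V'" "q0 \<in> V'" "V' \<subseteq> V" and Ck: "\<And>k j i. Ck_on k (\<lambda>q. y j q $ i) V'"
    and dual: "\<And>q i j. q \<in> V' \<Longrightarrow> i < d \<Longrightarrow> j < d \<Longrightarrow>
      pairing (complex_gradient (\<rho> i) q) (y j q) = (if i = j then 1 else 0)"
    by (rule smooth_dual_vectors[OF sd \<open>q0 \<in> V\<close>]) (rule that, assumption+)
  have V: "open V" using sd by (simp add: smooth_defining_def)
  have Ck\<tau>: "Ck_on (Suc k) \<tau> V" for k using \<tau>(1) unfolding smooth_on_def by blast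
  show ?thesis
  proof (rule that[OF V'])
    show "Ck_on k (\<lambda>q. pairing (complex_gradient \<tau> q) (y j q)) V'" for k j
      by (intro Ck_on_sum[OF V'(1)] Ck_on_mult[OF V'(1)] Ck
          Ck_on_subset[OF Ck_on_complex_gradient[OF V Ck\<tau>] V'(3)])
    show "complex_gradient \<tau> q
        = (\<Sum>j<d. pairing (complex_gradient \<tau> q) (y j q) *s complex_gradient (\<rho> j) q)"
      if "q \<in> M \<inter> V'" for q
      using that V'(3) \<tau>(2) dual
      by (intro gradient_in_span_of_defining_gradients[OF sd _ _ Ck_on_Suc_has_derivative[OF Ck\<tau>]]) auto
  qed
qed

lemma common_neighbourhood:
  fixes M :: "(complex^'n) set" and H :: "complex^'n \<Rightarrow> complex^'m"
  assumes "\<forall>L\<in>set Ls. cr_vector_field_near M p L" "p \<in> M"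
    and "Ck_on_submanifold k H M" "open V" "H p \<in> V"
  obtains W where "open W" "p \<in> W" "\<forall>L\<in>set Ls. cr_vector_field_on M W L" "H ` (M \<inter> W) \<subseteq> V"
proof -
  have "\<exists>W. open W \<and> p \<in> W \<and> (\<forall>L\<in>set Ls. cr_vector_field_on M W L)"
    using assms(1)
  proof (induction Ls)
    case (Cons L Ls)
    then obtain W where W: "open W" "p \<in> W" "\<forall>L\<in>set Ls. cr_vector_field_on M W L" by auto
    obtain W' where W': "p \<in> W'" "cr_vector_field_on M W' L"
      using Cons.prems by (auto simp: cr_vector_field_near_def)
    have "open (W \<inter> W')" using W(1) cr_vector_field_on_open[OF W'(2)] by blast
    then have "cr_vector_field_on M (W \<inter> W') L'" if "L' \<in> set (L # Ls)" for L'
      using that W(3) W'(2) cr_vector_field_on_subset[of M _ L' "W \<inter> W'"] by auto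
    then show ?case using \<open>open (W \<inter> W')\<close> W(2) W'(1) by (intro exI[of _ "W \<inter> W'"]) blast
  qed (auto intro: exI[of _ UNIV])
  then obtain W where W: "open W" "p \<in> W" "\<forall>L\<in>set Ls. cr_vector_field_on M W L" by blast
  obtain W' h where W': "open W'" "p \<in> W'" "Ck_on k h W'" "\<forall>x\<in>M \<inter> W'. h x = H x"
    using assms(2,3) unfolding Ck_on_submanifold_def by blast
  define W2 where "W2 = W \<inter> (W' \<inter> h -` V)"
  have "open W2"
    unfolding W2_def
    by (intro open_Int W continuous_open_preimage Ck_on_continuous[OF W'(3)] W'(1) assms(4))
  show ?thesis
  proof (rule that[OF \<open>open W2\<close>])
    show "p \<in> W2" using W W' assms(2,5) by (simp add: W2_def)
    show "\<forall>L\<in>set Ls. cr_vector_field_on M W2 L"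
      using W(3) cr_vector_field_on_subset[OF _ \<open>open W2\<close>] by (auto simp: W2_def)
    show "H ` (M \<inter> W2) \<subseteq> V" using W'(4) by (auto simp: W2_def)
  qed
qed

text \<open>One half of the independence of \<open>E\<^sub>k(0)\<close> from the defining function: at the points of \<open>H ` M\<close>
  near \<open>H 0\<close> the gradients of \<open>\<tau>\<close> are combinations of those of \<open>\<rho>\<close> with smooth coefficients, and the
  Leibniz rule applies to each summand. Exchanging two defining functions gives the other half.\<close>

lemma E_space_subset:
  fixes M :: "(complex^'n) set" and M' :: "(complex^'m) set"
  assumes "0 \<in> M" and H: "Ck_on_submanifold k H M" "H ` M \<subseteq> M'"
    and sd: "smooth_defining M' d' V \<rho>" and "H 0 \<in> V"
    and \<tau>: "\<And>l. l < d' \<Longrightarrow> smooth_on (\<tau> l) V" "\<And>l Z. l < d' \<Longrightarrow> Z \<in> M' \<inter> V \<Longrightarrow> \<tau> l Z = 0"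
  shows "E_space M d' \<tau> H k \<subseteq> E_space M d' \<rho> H k"
  unfolding E_space_def
proof (rule vec.span_minimal[OF _ vec.subspace_span], rule subsetI)
  let ?gen = "\<lambda>Ls u. (\<chi> i. foldr (bar_field M) Ls (u i) 0) :: complex^'m"
  let ?u = "\<lambda>l i Z. complex_gradient (\<rho> l) (H Z) $ i"
  let ?E = "{?gen Ls (?u l) | Ls l. (\<forall>L\<in>set Ls. cr_vector_field_near M 0 L) \<and> length Ls \<le> k \<and> l < d'}"
  fix v assume "v \<in> {(\<chi> i. foldr (bar_field M) Ls (\<lambda>Z. complex_gradient (\<tau> l) (H Z) $ i) 0) | Ls l.
      (\<forall>L\<in>set Ls. cr_vector_field_near M 0 L) \<and> length Ls \<le> k \<and> l < d'}"
  then obtain Ls l where v: "v = ?gen Ls (\<lambda>i Z. complex_gradient (\<tau> l) (H Z) $ i)"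
    and near: "\<forall>L\<in>set Ls. cr_vector_field_near M 0 L" and len: "length Ls \<le> k" and l: "l < d'"
    by blast
  obtain V' a where V': "open V'" "H 0 \<in> V'" "V' \<subseteq> V" and a: "\<And>k j. Ck_on k (a j) V'"
    and coeff: "\<And>q. q \<in> M' \<inter> V' \<Longrightarrow>
      complex_gradient (\<tau> l) q = (\<Sum>j<d'. a j q *s complex_gradient (\<rho> j) q)"
    by (rule gradient_coefficients[OF sd \<open>H 0 \<in> V\<close> \<tau>(1)[OF l] \<tau>(2)[OF l]])
      (assumption | rule that, assumption+)+
  obtain W where W: "open W" "0 \<in> W" "\<forall>L\<in>set Ls. cr_vector_field_on M W L" "H ` (M \<inter> W) \<subseteq> V'"
    by (rule common_neighbourhood[OF near \<open>0 \<in> M\<close> H(1) V'(1,2)]) (rule that, assumption+)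
  have 0: "0 \<in> M \<inter> W" using W(2) \<open>0 \<in> M\<close> by simp
  have HW: "Ck_on_submanifold (length Ls) H (M \<inter> W)"
    using Ck_on_submanifold_subset[OF Ck_on_submanifold_decr[OF H(1) len]] by blast
  have Cka: "Ck_on_submanifold (length Ls) (\<lambda>Z. a j (H Z)) (M \<inter> W)" for j
    by (rule Ck_on_submanifold_compose[OF HW V'(1) W(4) a])
  have Cku: "Ck_on_submanifold (length Ls) (?u j i) (M \<inter> W)" if "j < d'" for j i
  proof (rule Ck_on_submanifold_compose[OF HW V'(1) W(4)])
    have "open V" "Ck_on (Suc (length Ls)) (\<rho> j) V"
      using sd that unfolding smooth_defining_def smooth_on_def by blast+
    from Ck_on_subset[OF Ck_on_complex_gradient[OF this] V'(3)]
    show "Ck_on (length Ls) (\<lambda>q. complex_gradient (\<rho> j) q $ i) V'" .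
  qed
  have "complex_gradient (\<tau> l) (H Z) $ i = (\<Sum>j<d'. a j (H Z) * ?u j i Z)" if "Z \<in> M \<inter> W" for Z i
    using coeff[of "H Z"] that W(4) H(2) by (auto simp: image_subset_iff)
  from iterated_bar_field_cong[OF W(1) this 0]
  have "v = ?gen Ls (\<lambda>i Z. \<Sum>j<d'. a j (H Z) * ?u j i Z)" by (simp add: v)
  also have "\<dots> = (\<Sum>j<d'. ?gen Ls (\<lambda>i Z. a j (H Z) * ?u j i Z))"
  proof -
    have "foldr (bar_field M) Ls (\<lambda>Z. \<Sum>j<d'. a j (H Z) * ?u j i Z) 0
        = (\<Sum>j<d'. foldr (bar_field M) Ls (\<lambda>Z. a j (H Z) * ?u j i Z) 0)" for i
      by (intro iterated_bar_field_sum[OF W(1,3) _ 0] Ck_on_submanifold_mult Cka Cku) simp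
    then show ?thesis by (simp only: vec_eq_iff sum_component vec_lambda_beta) blast
  qed
  also have "\<dots> \<in> vec.span ?E"
  proof (rule vec.span_sum)
    fix j assume "j \<in> {..<d'}"
    then have j: "j < d'" by simp
    have "{?gen Ks (?u j) | Ks. set Ks \<subseteq> set Ls \<and> length Ks \<le> length Ls} \<subseteq> ?E"
      using near len j by (fastforce intro: order_trans)
    from vec.span_mono[OF this]
      iterated_bar_field_mult_in_span[OF W(1) 0 W(3) Cka, of "?u j", OF Cku[OF j]]
    show "?gen Ls (\<lambda>i Z. a j (H Z) * ?u j i Z) \<in> vec.span ?E" by (rule subsetD)
  qed
  finally show "v \<in> vec.span ?E" .
qed

section \<open>Change of the holomorphic coordinates\<close>

lemma cr_map_bar_field_component:
  assumes "cr_map k M M' H" "0 < k" "cr_vector_field_on M W a" "p \<in> M \<inter> W"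
  shows "bar_field M a (\<lambda>Z. H Z $ i) p = 0"
proof -
  have "Ck_on_submanifold 1 H M"
    using assms(1,2) Ck_on_submanifold_decr[of k H M 1] by (simp add: cr_map_def)
  then have "Ck_on_submanifold 1 (\<lambda>Z. H Z $ i) M"
    by (rule Ck_on_submanifold_compose[OF _ open_UNIV subset_UNIV
          Ck_on_vec_nth[OF open_UNIV Ck_on_id[OF open_UNIV]]])
  moreover have "cr_function M (\<lambda>Z. H Z $ i)" using assms(1) by (simp add: cr_map_def)
  ultimately show ?thesis using assms(3,4) unfolding cr_function_def by metis
qed

text \<open>Chain rule: the derivative of \<open>\<phi>\<close> is complex linear, so \<open>L (\<phi> \<circ> H) = \<Sum>\<^sub>i \<phi>\<^sub>i (L H\<^sub>i)\<close> without a term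
  containing \<open>L\<close> of the conjugate of \<open>H\<close>.\<close>

lemma bar_field_holomorphic_compose:
  fixes H :: "complex^'n \<Rightarrow> complex^'m"
  assumes cr: "cr_vector_field_on M W a" "p \<in> M \<inter> W"
    and H: "H differentiable (at p within M)" "\<And>i. bar_field M a (\<lambda>Z. H Z $ i) p = 0"
    and \<phi>: "holomorphic_fun_on \<phi> U" "H p \<in> U"
  shows "(\<lambda>Z. \<phi> (H Z)) differentiable (at p within M)"
    and "bar_field M a (\<lambda>Z. \<phi> (H Z)) p = 0"
proof -
  obtain D where D: "(H has_derivative D) (at p within M)"
    using H(1) by (auto simp: differentiable_def)
  have "(\<phi> has_derivative (\<lambda>h. \<Sum>i\<in>UNIV. dZ i \<phi> (H p) * h $ i)) (at (H p))"
    using \<phi> by (simp add: holomorphic_fun_on_def)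
  from has_derivative_compose[OF D this]
  have \<phi>H: "((\<lambda>Z. \<phi> (H Z)) has_derivative (\<lambda>h. \<Sum>i\<in>UNIV. dZ i \<phi> (H p) * D h $ i)) (at p within M)" .
  then show "(\<lambda>Z. \<phi> (H Z)) differentiable (at p within M)" by (rule differentiableI)
  have Hi: "bar_deriv (a p) (\<lambda>h. D h $ i) = 0" for i
    using bar_field_eq[OF cr bounded_linear.has_derivative[OF bounded_linear_vec_nth D]] H(2) by metis
  have "bar_field M a (\<lambda>Z. \<phi> (H Z)) p = bar_deriv (a p) (\<lambda>h. \<Sum>i\<in>UNIV. dZ i \<phi> (H p) * D h $ i)"
    by (rule bar_field_eq[OF cr \<phi>H])
  also have "\<dots> = (\<Sum>j\<in>UNIV. \<Sum>i\<in>UNIV. dZ i \<phi> (H p) *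
      (a p $ j * ((D (axis j 1) $ i + \<i> * D (axis j \<i>) $ i) / 2)))"
    unfolding bar_deriv_def
    by (intro sum.cong refl)
      (simp add: sum_distrib_left sum_distrib_right sum.distrib[symmetric] sum_divide_distrib
        distrib_left mult_ac)
  also have "\<dots> = (\<Sum>i\<in>UNIV. dZ i \<phi> (H p) * bar_deriv (a p) (\<lambda>h. D h $ i))"
    unfolding bar_deriv_def sum_distrib_left by (rule sum.swap)
  finally show "bar_field M a (\<lambda>Z. \<phi> (H Z)) p = 0" by (simp add: Hi)
qed

lemma jacobian_Z_invertible:
  fixes F :: "complex^'m \<Rightarrow> complex^'m"
  assumes "biholomorphic_on F U" "q \<in> U"
  shows "invertible (jacobian_Z F q)"
proof -
  obtain G where G: "holomorphic_map_on G (F ` U)" "\<forall>z\<in>U. G (F z) = z"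
    and F: "open U" "holomorphic_map_on F U"
    using assms(1) unfolding biholomorphic_on_def by blast
  have "((\<lambda>z. G (F z)) has_derivative (\<lambda>h. jacobian_Z G (F q) *v (jacobian_Z F q *v h))) (at q)"
    by (rule has_derivative_compose[OF holomorphic_map_has_derivative[OF F(2) assms(2)]
          holomorphic_map_has_derivative[OF G(1) imageI[OF assms(2)]]])
  moreover have "((\<lambda>z. G (F z)) has_derivative (\<lambda>h. h)) (at q)"
    by (rule has_derivative_transform_within_open[OF has_derivative_ident F(1) assms(2)])
      (simp add: G(2))
  ultimately have "(\<lambda>h. jacobian_Z G (F q) *v (jacobian_Z F q *v h)) = (\<lambda>h. h)"
    by (rule has_derivative_unique)
  then have "jacobian_Z G (F q) *v (jacobian_Z F q *v h) = h" for h
    by (rule fun_cong)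
  then have "jacobian_Z G (F q) ** jacobian_Z F q = mat 1"
    by (simp add: matrix_eq matrix_vector_mul_assoc)
  then show ?thesis using invertible_left_inverse by blast
qed

lemma linear_vector_matrix_mult:
  fixes A :: "'a::field^'m^'n"
  shows "Vector_Spaces.linear (*s) (*s) (\<lambda>v. v v* A)"
proof -
  have "(\<lambda>v. v v* A) = (*v) (transpose A)" by (rule ext) simp
  then show ?thesis using matrix_vector_mul_linear_gen[of "transpose A"] by simp
qed

lemma pairing_matrix_vector:
  "pairing g (A *v v) = pairing (g v* A) v"
  unfolding matrix_vector_mult_def vector_matrix_mult_def vec_lambda_beta
    sum_distrib_left sum_distrib_right
  by (subst sum.swap) (simp add: mult_ac)

lemma complex_gradient_compose:
  assumes "holomorphic_map_on F U" "q \<in> U" "(r has_derivative D) (at (F q))"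
  shows "complex_gradient (r \<circ> F) q = complex_gradient r (F q) v* jacobian_Z F q"
proof (rule complex_gradient_eqI)
  have "((\<lambda>x. r (F x)) has_derivative (\<lambda>v. D (jacobian_Z F q *v v))) (at q)"
    by (rule has_derivative_compose[OF holomorphic_map_has_derivative[OF assms(1,2)] assms(3)])
  then show "((r \<circ> F) has_derivative
      (\<lambda>v. 2 * Re (pairing (complex_gradient r (F q) v* jacobian_Z F q) v))) (at q)"
    by (simp only: comp_def derivative_eq_pairing_gradient[OF assms(3)] pairing_matrix_vector)
qed

lemma holomorphic_map_imp_Ck:
  assumes "open U" "holomorphic_map_on F U"
  shows "Ck_on k F U"
  by (rule Ck_on_vecI[OF assms(1) holomorphic_fun_imp_Ck[OF assms(1) holomorphic_map_component[OF assms(2)]]])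

text \<open>Injectivity of \<open>F\<close> identifies the zero set of \<open>\<rho> \<circ> F\<close> with \<open>M\<close>, and invertibility of the Jacobian matrix
  preserves the independence of the gradients.\<close>

lemma smooth_defining_pullback:
  fixes F :: "complex^'m \<Rightarrow> complex^'m"
  assumes bi: "biholomorphic_on F U" and "q0 \<in> U" "F q0 \<in> V"
    and sd: "smooth_defining (F ` (M \<inter> U)) d V \<rho>"
  obtains V' where "q0 \<in> V'" "V' \<subseteq> U" "F ` V' \<subseteq> V" "smooth_defining M d V' (\<lambda>l. \<rho> l \<circ> F)"
proof -
  obtain G where G: "\<forall>z\<in>U. G (F z) = z" and F: "open U" "holomorphic_map_on F U"
    using bi unfolding biholomorphic_on_def by blast
  have V: "open V" and Ck\<rho>: "\<And>l k. l < d \<Longrightarrow> Ck_on k (\<rho> l) V"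
    using sd unfolding smooth_defining_def smooth_on_def by blast+
  define V' where "V' = U \<inter> F -` V"
  have V': "open V'"
    unfolding V'_def
    by (intro continuous_open_preimage Ck_on_continuous[OF holomorphic_map_imp_Ck[OF F]] F(1) V)
  have FV': "F ` V' \<subseteq> V" by (auto simp: V'_def)
  show ?thesis
  proof (rule that)
    show "smooth_defining M d V' (\<lambda>l. \<rho> l \<circ> F)"
      unfolding smooth_defining_def
    proof (intro conjI V')
      have mem: "q \<in> M \<longleftrightarrow> F q \<in> F ` (M \<inter> U)" if "q \<in> U" for q
        using G that by (metis IntD1 IntD2 IntI image_iff)
      have "F ` (M \<inter> U) \<inter> V = {Z \<in> V. \<forall>j<d. \<rho> j Z = 0}"
        using sd by (simp add: smooth_defining_def)
      then have "q \<in> M \<longleftrightarrow> (\<forall>j<d. (\<rho> j \<circ> F) q = 0)" if "q \<in> V'" for q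
        using mem[of q] that unfolding V'_def comp_def by blast
      then show "M \<inter> V' = {Z \<in> V'. \<forall>j<d. (\<rho> j \<circ> F) Z = 0}" by blast
      show "\<forall>j<d. smooth_on (\<rho> j \<circ> F) V'"
        unfolding smooth_on_def comp_def
      proof (intro allI impI)
        fix j k assume "j < d"
        have "Ck_on k F V'"
          using holomorphic_map_imp_Ck[OF F] by (rule Ck_on_subset) (simp add: V'_def)
        then show "Ck_on k (\<lambda>x. \<rho> j (F x)) V'"
          using Ck\<rho>[OF \<open>j < d\<close>] by (rule Ck_on_compose[OF V' V FV'])
      qed
      show "\<forall>q\<in>V'. \<forall>c. (\<Sum>j<d. c j *s complex_gradient (\<rho> j \<circ> F) q) = 0 \<longrightarrow> (\<forall>j<d. c j = 0)"
      proof (intro ballI allI impI)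
        fix q c j
        assume q: "q \<in> V'" and dep: "(\<Sum>j<d. c j *s complex_gradient (\<rho> j \<circ> F) q) = 0" and "j < d"
        have qU: "q \<in> U" and Fq: "F q \<in> V" using q by (auto simp: V'_def)
        obtain B where B: "jacobian_Z F q ** B = mat 1"
          using jacobian_Z_invertible[OF bi qU] unfolding invertible_def by blast
        have grad: "complex_gradient (\<rho> j \<circ> F) q v* B = complex_gradient (\<rho> j) (F q)" if "j < d" for j
          using complex_gradient_compose[OF F(2) qU Ck_on_Suc_has_derivative[OF Ck\<rho>[OF that] Fq]]
          by (simp add: vector_matrix_mul_assoc B)
        note lin = linear_vector_matrix_mult[of B]
        have "0 = (\<Sum>j<d. c j *s complex_gradient (\<rho> j \<circ> F) q) v* B" by (simp add: dep)
        also have "\<dots> = (\<Sum>j<d. c j *s (complex_gradient (\<rho> j \<circ> F) q v* B))"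
          by (simp only: vec.linear_sum[OF lin] vec.linear_scale[OF lin])
        also have "\<dots> = (\<Sum>j<d. c j *s complex_gradient (\<rho> j) (F q))"
          using grad by (intro sum.cong) auto
        finally have "(\<Sum>j<d. c j *s complex_gradient (\<rho> j) (F q)) = 0" by (rule sym)
        moreover have "\<forall>Z\<in>V. \<forall>c. (\<Sum>j<d. c j *s complex_gradient (\<rho> j) Z) = 0 \<longrightarrow> (\<forall>j<d. c j = 0)"
          using sd unfolding smooth_defining_def by (elim conjE)
        ultimately show "c j = 0" using Fq \<open>j < d\<close> by blast
      qed
    qed
  qed (use assms(2,3) FV' in \<open>auto simp: V'_def\<close>)
qed

text \<open>Each generator for \<open>\<rho> \<circ> F\<close> and \<open>H\<close> is the corresponding generator for \<open>\<rho>\<close> and \<open>F \<circ> H\<close> times the Jacobian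
  matrix at \<open>H 0\<close>: along \<open>M\<close> the gradients differ by the factor \<open>J \<circ> H\<close>, whose entries are CR.\<close>

lemma E_space_pullback:
  fixes M :: "(complex^'n) set" and H :: "complex^'n \<Rightarrow> complex^'m" and F :: "complex^'m \<Rightarrow> complex^'m"
  assumes "0 \<in> M" and cr: "cr_map k\<^sub>0 M M' H" and "k \<le> k\<^sub>0"
    and F: "open U" "holomorphic_map_on F U" "H 0 \<in> V'" "open V'" "V' \<subseteq> U" "F ` V' \<subseteq> V"
    and \<rho>: "open V" "\<And>l. l < d' \<Longrightarrow> smooth_on (\<rho> l) V"
  shows "E_space M d' (\<lambda>l. \<rho> l \<circ> F) H k
    = (\<lambda>v. v v* jacobian_Z F (H 0)) ` E_space M d' \<rho> (F \<circ> H) k"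
proof -
  let ?gen = "\<lambda>Ls u. (\<chi> i. foldr (bar_field M) Ls (u i) 0) :: complex^'m"
  let ?T = "\<lambda>l i Z. complex_gradient (\<rho> l) ((F \<circ> H) Z) $ i"
  let ?J = "jacobian_Z F (H 0)"
  have H: "Ck_on_submanifold k\<^sub>0 H M" using cr by (simp add: cr_map_def)
  have gen: "?gen Ls (\<lambda>i Z. complex_gradient (\<rho> l \<circ> F) (H Z) $ i) = ?gen Ls (?T l) v* ?J"
    if near: "\<forall>L\<in>set Ls. cr_vector_field_near M 0 L" and len: "length Ls \<le> k" and l: "l < d'" for Ls l
  proof -
    obtain W where W: "open W" "0 \<in> W" "\<forall>L\<in>set Ls. cr_vector_field_on M W L" "H ` (M \<inter> W) \<subseteq> V'"
      by (rule common_neighbourhood[OF near \<open>0 \<in> M\<close> H F(4,3)]) (rule that, assumption+)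
    have 0: "0 \<in> M \<inter> W" using W(2) \<open>0 \<in> M\<close> by simp
    have HW: "Ck_on_submanifold (length Ls) H (M \<inter> W)"
      using Ck_on_submanifold_subset[OF Ck_on_submanifold_decr[OF H, of "length Ls"]] len \<open>k \<le> k\<^sub>0\<close> by simp
    have CkF: "Ck_on j F V'" for j
      using holomorphic_map_imp_Ck[OF F(1,2)] F(5) by (rule Ck_on_subset)
    have Ck\<rho>: "Ck_on j (\<rho> l) V" for j using \<rho>(2)[OF l] by (simp add: smooth_on_def)
    have J_hol: "holomorphic_fun_on (\<lambda>q. jacobian_Z F q $ m $ i) U" for m i
      unfolding jacobian_Z_def vec_lambda_beta
      by (rule holomorphic_fun_on_dZ[OF F(1) holomorphic_map_component[OF F(2)]])
    let ?K = "\<lambda>m i Z. jacobian_Z F (H Z) $ m $ i"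
    have CkK: "Ck_on_submanifold (length Ls) (?K m i) (M \<inter> W)" for m i
      by (rule Ck_on_submanifold_compose[OF HW F(4) W(4)
            Ck_on_subset[OF holomorphic_fun_imp_Ck[OF F(1) J_hol] F(5)]])
    have CkT: "Ck_on_submanifold (length Ls) (?T l m) (M \<inter> W)" for m
      unfolding comp_def
      by (rule Ck_on_submanifold_compose[OF HW F(4) W(4)
            Ck_on_compose[OF F(4) \<rho>(1) F(6) CkF Ck_on_complex_gradient[OF \<rho>(1) Ck\<rho>]]])
    have K_CR: "?K m i differentiable (at x within M) \<and> bar_field M L (?K m i) x = 0"
      if L: "L \<in> set Ls" and x: "x \<in> M \<inter> W" for L x m i
    proof -
      \<comment> \<open>For \<open>k\<^sub>0 = 0\<close> no vector field occurs; otherwise \<open>H\<close> is \<open>C\<^sup>1\<close> and the CR condition holds pointwise.\<close>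
      have "Suc 0 \<le> length Ls" using L by (cases Ls) auto
      then have "0 < k\<^sub>0" using len \<open>k \<le> k\<^sub>0\<close> by simp
      have cr_L: "cr_vector_field_on M W L" using W(3) L by blast
      have "H differentiable (at x within M)"
        using Ck_on_submanifold_differentiable[OF Ck_on_submanifold_decr[OF HW \<open>Suc 0 \<le> _\<close>] W(1) x] .
      moreover have "H x \<in> U" using x W(4) F(5) by blast
      ultimately show ?thesis
        using bar_field_holomorphic_compose[OF cr_L x _
            cr_map_bar_field_component[OF cr \<open>0 < k\<^sub>0\<close> cr_L x] J_hol] by blast
    qed
    have grad: "complex_gradient (\<rho> l \<circ> F) (H Z) $ i = (\<Sum>m\<in>UNIV. ?T l m Z * ?K m i Z)"
      if "Z \<in> M \<inter> W" for Z i
    proof -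
      have HZ: "H Z \<in> V'" using that W(4) by blast
      then have "F (H Z) \<in> V" using F(6) by blast
      from complex_gradient_compose[OF F(2) subsetD[OF F(5) HZ] Ck_on_Suc_has_derivative[OF Ck\<rho> this]]
      show ?thesis by (simp add: vector_matrix_mult_def)
    qed
    have "foldr (bar_field M) Ls (\<lambda>Z. complex_gradient (\<rho> l \<circ> F) (H Z) $ i) 0
        = (\<Sum>m\<in>UNIV. foldr (bar_field M) Ls (?T l m) 0 * ?K m i 0)" for i
    proof -
      have "foldr (bar_field M) Ls (\<lambda>Z. complex_gradient (\<rho> l \<circ> F) (H Z) $ i) 0
          = foldr (bar_field M) Ls (\<lambda>Z. \<Sum>m\<in>UNIV. ?T l m Z * ?K m i Z) 0"
        by (rule iterated_bar_field_cong[OF W(1) grad 0])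
      also have "\<dots> = (\<Sum>m\<in>UNIV. foldr (bar_field M) Ls (\<lambda>Z. ?T l m Z * ?K m i Z) 0)"
        by (rule iterated_bar_field_sum[OF W(1,3) Ck_on_submanifold_mult[OF CkT CkK] 0])
      also have "\<dots> = (\<Sum>m\<in>UNIV. foldr (bar_field M) Ls (?T l m) 0 * ?K m i 0)"
        by (intro sum.cong refl iterated_bar_field_mult_CR[OF W(1,3) CkT K_CR 0])
      finally show ?thesis .
    qed
    then show ?thesis by (simp add: vec_eq_iff vector_matrix_mult_def)
  qed
  let ?P = "\<lambda>Ls l. (\<forall>L\<in>set Ls. cr_vector_field_near M 0 L) \<and> length Ls \<le> k \<and> l < d'"
  have "{?gen Ls (\<lambda>i Z. complex_gradient (\<rho> l \<circ> F) (H Z) $ i) | Ls l. ?P Ls l}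
      = (\<lambda>v. v v* ?J) ` {?gen Ls (?T l) | Ls l. ?P Ls l}"
  proof (intro subset_antisym subsetI)
    fix v assume "v \<in> {?gen Ls (\<lambda>i Z. complex_gradient (\<rho> l \<circ> F) (H Z) $ i) | Ls l. ?P Ls l}"
    then obtain Ls l where "?P Ls l" "v = ?gen Ls (\<lambda>i Z. complex_gradient (\<rho> l \<circ> F) (H Z) $ i)" by blast
    then show "v \<in> (\<lambda>v. v v* ?J) ` {?gen Ls (?T l) | Ls l. ?P Ls l}"
      using gen[of Ls l] by (intro image_eqI[of _ _ "?gen Ls (?T l)"]) blast+
  next
    fix v assume "v \<in> (\<lambda>v. v v* ?J) ` {?gen Ls (?T l) | Ls l. ?P Ls l}"
    then obtain Ls l where "?P Ls l" "v = ?gen Ls (?T l) v* ?J" by blast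
    then show "v \<in> {?gen Ls (\<lambda>i Z. complex_gradient (\<rho> l \<circ> F) (H Z) $ i) | Ls l. ?P Ls l}"
      using gen[of Ls l] by (intro CollectI exI[of _ Ls] exI[of _ l]) simp
  qed
  then show ?thesis
    unfolding E_space_def by (simp only: vec.linear_span_image[OF linear_vector_matrix_mult])
qed

theorem lemma3:
  fixes M :: "(complex^'n) set" and M' :: "(complex^'m) set"
    and H :: "complex^'n \<Rightarrow> complex^'m" and F :: "complex^'m \<Rightarrow> complex^'m"
    and U :: "(complex^'m) set"
    and \<rho>' \<rho>t :: "nat \<Rightarrow> complex^'m \<Rightarrow> real"
    and d d' k\<^sub>0 k :: nat
  assumes "generic_submanifold M d" and "0 \<in> M"
    and "generic_submanifold M' d'" and "0 \<in> M'"
    and "cr_map k\<^sub>0 M M' H" and "H 0 = 0"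
    and "0 \<in> U" and "biholomorphic_on F U" and "F 0 = 0"
    and "local_defining_function M' d' 0 \<rho>'"
    and "local_defining_function (F ` (M' \<inter> U)) d' 0 \<rho>t"
    and "k \<le> k\<^sub>0"
  shows "E_space M d' \<rho>t (F \<circ> H) k =
    (\<lambda>v. v v* matrix_inv (jacobian_Z F 0)) ` E_space M d' \<rho>' H k"
proof -
  let ?J = "jacobian_Z F 0" and ?\<tau> = "\<lambda>l. \<rho>t l \<circ> F"
  obtain V\<rho> where V\<rho>: "0 \<in> V\<rho>" "smooth_defining M' d' V\<rho> \<rho>'"
    using local_defining_imp_smooth[OF assms(10)] by blast
  obtain Vt where Vt: "0 \<in> Vt" "smooth_defining (F ` (M' \<inter> U)) d' Vt \<rho>t"
    using local_defining_imp_smooth[OF assms(11)] by blast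
  have F: "open U" "holomorphic_map_on F U" using assms(8) by (auto simp: biholomorphic_on_def)
  have "F 0 \<in> Vt" using Vt(1) assms(9) by simp
  obtain V\<tau> where V\<tau>: "0 \<in> V\<tau>" "V\<tau> \<subseteq> U" "F ` V\<tau> \<subseteq> Vt" "smooth_defining M' d' V\<tau> ?\<tau>"
    by (rule smooth_defining_pullback[OF assms(8,7) \<open>F 0 \<in> Vt\<close> Vt(2)]) (rule that, assumption+)
  have open_V: "open V\<rho>" "open V\<tau>" "open Vt"
    using V\<rho>(2) V\<tau>(4) Vt(2) by (simp_all add: smooth_defining_def)
  define V where "V = V\<rho> \<inter> V\<tau>"
  have V: "smooth_defining M' d' V \<rho>'" "smooth_defining M' d' V ?\<tau>" "H 0 \<in> V"
    using smooth_defining_mono[OF V\<rho>(2), of V] smooth_defining_mono[OF V\<tau>(4), of V]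
      open_V V\<rho>(1) V\<tau>(1) assms(6) by (auto simp: V_def)
  have smooth: "smooth_on (r l) V" "\<And>Z. Z \<in> M' \<inter> V \<Longrightarrow> r l Z = 0"
    if "smooth_defining M' d' V r" "l < d'" for r l
    using that unfolding smooth_defining_def by blast+
  have H: "Ck_on_submanifold k H M" "H ` M \<subseteq> M'"
    using assms(5) Ck_on_submanifold_decr[OF _ assms(12)] by (auto simp: cr_map_def)
  have change_\<rho>: "E_space M d' ?\<tau> H k = E_space M d' \<rho>' H k"
    by (intro subset_antisym E_space_subset[OF assms(2) H V(1,3) smooth[OF V(2)]]
        E_space_subset[OF assms(2) H V(2,3) smooth[OF V(1)]])
  have change_Z: "E_space M d' ?\<tau> H k = (\<lambda>v. v v* ?J) ` E_space M d' \<rho>t (F \<circ> H) k"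
  proof -
    have "H 0 \<in> V\<tau>" using V\<tau>(1) assms(6) by simp
    moreover have "smooth_on (\<rho>t l) Vt" if "l < d'" for l
      using Vt(2) that by (simp add: smooth_defining_def)
    ultimately show ?thesis
      using E_space_pullback[OF assms(2,5,12) F _ open_V(2) V\<tau>(2,3) open_V(3)] assms(6) by simp
  qed
  have "?J ** matrix_inv ?J = mat 1"
    using someI_ex[OF jacobian_Z_invertible[OF assms(8,7), unfolded invertible_def]]
    unfolding matrix_inv_def by (rule conjunct1)
  then have cancel: "(v v* ?J) v* matrix_inv ?J = v" for v
    by (simp add: vector_matrix_mul_assoc)
  show ?thesis
    unfolding change_\<rho>[symmetric] change_Z image_image cancel by simp
qed

end
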